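(* Let $K_5-e$ be the graph obtained from the complete graph $K_5$ by deleting one edge. For every real $\beta>1$, the function $T_{K_5-e}^{-\beta}$ is completely monotone on its positive edge cone $(0,\infty)^{E(K_5-e)}$. Hence $K_5-e\in\mathcal{G}_\beta$ for every $1<\beta<3/2$.
   Context: For a finite connected graph $G=(V,E)$, the spanning-tree polynomial is $T_G(x)=\sum_{T\in\mathcal{T}(G)}\prod_{e\in T}x_e$, $x=(x_e)_{e\in E}$, where $\mathcal{T}(G)$ is the set of spanning trees of $G$. A function $f\in C^\infty((0,\infty)^n)$ is completely monotone if $(-1)^{|\alpha|}\partial^\alpha f(x)\ge 0$ for all multi-indices $\alpha\in\mathbb{N}^n$ and all $x\in(0,\infty)^n$. For $\beta>0$, $\mathcal{G}_\beta$ denotes the class of finite connected graphs $G$ such that $T_G^{-\beta}$ is completely monotone on $(0,\infty)^E$. *)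

theory Defs
  imports "HOL-Analysis.Analysis"
begin

(* Graphs are undirected: an edge is the two-element set of its ends. *)
type_synonym 'a ugraph = "'a set \<times> 'a set set"

abbreviation ug_verts :: "'a ugraph \<Rightarrow> 'a set" where
  "ug_verts \<equiv> fst"

abbreviation ug_edges :: "'a ugraph \<Rightarrow> 'a set set" where
  "ug_edges \<equiv> snd"

definition finite_ugraph :: "'a ugraph \<Rightarrow> bool" where
  "finite_ugraph G \<longleftrightarrow>
     finite (ug_verts G) \<and> ug_edges G \<subseteq> {e. e \<subseteq> ug_verts G \<and> card e = 2}"

definition ug_connected :: "'a ugraph \<Rightarrow> bool" where
  "ug_connected G \<longleftrightarrow> ug_verts G \<noteq> {} \<and>
     (\<forall>u\<in>ug_verts G. \<forall>v\<in>ug_verts G. (u, v) \<in> {(a, b). {a, b} \<in> ug_edges G}\<^sup>*)"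

definition ug_cycle :: "'a ugraph \<Rightarrow> 'a list \<Rightarrow> bool" where
  "ug_cycle G vs \<longleftrightarrow> 3 \<le> length vs \<and> distinct vs \<and>
     (\<forall>i<length vs. {vs ! i, vs ! (Suc i mod length vs)} \<in> ug_edges G)"

definition ug_tree :: "'a ugraph \<Rightarrow> bool" where
  "ug_tree G \<longleftrightarrow> ug_connected G \<and> (\<nexists>vs. ug_cycle G vs)"

definition spanning_trees :: "'a ugraph \<Rightarrow> 'a set set set" where
  "spanning_trees G = {T. T \<subseteq> ug_edges G \<and> ug_tree (ug_verts G, T)}"

definition spanning_tree_poly :: "'a ugraph \<Rightarrow> ('a set \<Rightarrow> real) \<Rightarrow> real" where
  "spanning_tree_poly G x = (\<Sum>T\<in>spanning_trees G. \<Prod>e\<in>T. x e)"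

(* The cone (0,\<infinity>)^I; points are extensional, so that functions on the cone depend
   only on the coordinates in I. *)
definition pos_cone :: "'i set \<Rightarrow> ('i \<Rightarrow> real) set" where
  "pos_cone I = (\<Pi>\<^sub>E i\<in>I. {0<..})"

definition partial_deriv :: "'i \<Rightarrow> (('i \<Rightarrow> real) \<Rightarrow> real) \<Rightarrow> ('i \<Rightarrow> real) \<Rightarrow> real" where
  "partial_deriv i f x = deriv (\<lambda>t. f (x(i := t))) (x i)"

(* iter_partial [i1, ..., ik] f is the partial derivative d_i1 (... (d_ik f)). *)
definition iter_partial :: "'i list \<Rightarrow> (('i \<Rightarrow> real) \<Rightarrow> real) \<Rightarrow> ('i \<Rightarrow> real) \<Rightarrow> real" where
  "iter_partial is f = foldr partial_deriv is f"

(* C-infinity: iterated partial derivatives of all orders exist and are continuous.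
   deriv is only meaningful where the derivative exists, hence the explicit
   differentiability clause. *)
definition smooth_on_cone :: "'i set \<Rightarrow> (('i \<Rightarrow> real) \<Rightarrow> real) \<Rightarrow> bool" where
  "smooth_on_cone I f \<longleftrightarrow> (\<forall>is\<in>lists I.
     continuous_on (pos_cone I) (iter_partial is f) \<and>
     (\<forall>x\<in>pos_cone I. \<forall>i\<in>I.
        (\<lambda>t. iter_partial is f (x(i := t))) field_differentiable at (x i)))"

(* A multi-index alpha on I corresponds to the lists over I in which each i occurs
   alpha_i times; all these lists have length |alpha|, and by the symmetry of the
   partial derivatives of a smooth function they all give the same derivative. *)
definition completely_monotone :: "'i set \<Rightarrow> (('i \<Rightarrow> real) \<Rightarrow> real) \<Rightarrow> bool" where
  "completely_monotone I f \<longleftrightarrow> smooth_on_cone I f \<and>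
     (\<forall>is\<in>lists I. \<forall>x\<in>pos_cone I. 0 \<le> (-1) ^ length is * iter_partial is f x)"

definition cm_graphs :: "real \<Rightarrow> 'a ugraph set" where
  "cm_graphs \<beta> = {G. finite_ugraph G \<and> ug_connected G \<and>
     completely_monotone (ug_edges G) (\<lambda>x. spanning_tree_poly G x powr (-\<beta>))}"

definition complete_ugraph :: "'a set \<Rightarrow> 'a ugraph" where
  "complete_ugraph V = (V, {e. e \<subseteq> V \<and> card e = 2})"

definition delete_edge :: "'a ugraph \<Rightarrow> 'a set \<Rightarrow> 'a ugraph" where
  "delete_edge G e = (ug_verts G, ug_edges G - {e})"

end

theory Submission
  imports Defs "HOL-Probability.Distributions"
begin

text \<open>
  Let \<open>a\<close>, \<open>b\<close> be the two non-adjacent vertices and \<open>A\<close>, \<open>B\<close> their weighted degrees.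
  Eliminating them by two star-triangle transformations gives \<open>T = A B det S\<close>, where \<open>S\<close> is
  the \<open>2 \<times> 2\<close> grounded Laplacian of the resulting weighted triangle. Since \<open>\<beta> > 1/2\<close>,
  \<open>det S powr (-\<beta>)\<close> is a Wishart mixture of exponentials \<open>exp (- tr (S M))\<close>. Such an exponential
  is in general not completely monotone in the original weights, but
  \<open>exp (- tr (S M)) / (A B)\<close> is: it is, up to a constant, the Gaussian integral, over positions of \<open>a\<close> and \<open>b\<close> in the plane, of
  \<open>exp (- (\<Sum>e=uv. x\<^sub>e |P\<^sub>u - P\<^sub>v|\<^sup>2))\<close>. The remaining factor \<open>(A B) powr (-(\<beta> - 1))\<close> is completely
  monotone because \<open>\<beta> > 1\<close>.

  Signs of derivatives are replaced by signs of iterated finite differences, which commute with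
  integrals and pointwise limits; the two notions agree for smooth functions.
\<close>

section \<open>Functions with alternating finite differences\<close>

definition shift :: "'i \<Rightarrow> real \<Rightarrow> ('i \<Rightarrow> real) \<Rightarrow> 'i \<Rightarrow> real" where
  "shift i h x = x(i := x i + h)"

text \<open>All iterated differences \<open>f x - f (shift i h x)\<close> of order at most k are
  nonnegative on the cone; directions and step sizes may vary from one difference to the next.
  Demanding nonnegativity at every order makes the property monotone in k, which the product rule
  needs.\<close>

primrec alternating :: "'i set \<Rightarrow> nat \<Rightarrow> (('i \<Rightarrow> real) \<Rightarrow> real) \<Rightarrow> bool" where
  "alternating I 0 f \<longleftrightarrow> (\<forall>x\<in>pos_cone I. 0 \<le> f x)"
| "alternating I (Suc k) f \<longleftrightarrow> (\<forall>x\<in>pos_cone I. 0 \<le> f x) \<and>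
     (\<forall>i\<in>I. \<forall>h>0. alternating I k (\<lambda>x. f x - f (shift i h x)))"

definition fully_alternating :: "'i set \<Rightarrow> (('i \<Rightarrow> real) \<Rightarrow> real) \<Rightarrow> bool" where
  "fully_alternating I f \<longleftrightarrow> (\<forall>k. alternating I k f)"

lemma pos_coneD: "x \<in> pos_cone I \<Longrightarrow> i \<in> I \<Longrightarrow> 0 < x i"
  unfolding pos_cone_def by auto

lemma pos_cone_upd: "x \<in> pos_cone I \<Longrightarrow> i \<in> I \<Longrightarrow> 0 < t \<Longrightarrow> x(i := t) \<in> pos_cone I"
  unfolding pos_cone_def by (auto simp: PiE_def extensional_def)

lemma pos_cone_shift:
  assumes "x \<in> pos_cone I" "i \<in> I" "0 < h"
  shows "shift i h x \<in> pos_cone I"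
  using assms pos_coneD[OF assms(1,2)] unfolding shift_def by (intro pos_cone_upd) auto

lemma alternating_SucI:
  assumes "\<And>x. x \<in> pos_cone I \<Longrightarrow> 0 \<le> f x"
    and "\<And>i h. i \<in> I \<Longrightarrow> 0 < h \<Longrightarrow> alternating I k (\<lambda>x. f x - f (shift i h x))"
  shows "alternating I (Suc k) f"
  using assms by simp

lemma alternating_diff:
  "alternating I (Suc k) f \<Longrightarrow> i \<in> I \<Longrightarrow> 0 < h \<Longrightarrow> alternating I k (\<lambda>x. f x - f (shift i h x))"
  by simp

lemma alternating_nonneg: "alternating I k f \<Longrightarrow> x \<in> pos_cone I \<Longrightarrow> 0 \<le> f x"
  by (cases k) simp_all

lemma alternating_cong:
  assumes "alternating I k f" "\<And>x. x \<in> pos_cone I \<Longrightarrow> f x = g x"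
  shows "alternating I k g"
  using assms
proof (induction k arbitrary: f g)
  case (Suc k)
  show ?case
  proof (rule alternating_SucI)
    show "0 \<le> g x" if "x \<in> pos_cone I" for x
      using alternating_nonneg[OF Suc.prems(1) that] Suc.prems(2)[OF that] by simp
    show "alternating I k (\<lambda>x. g x - g (shift i h x))" if i: "i \<in> I" "0 < h" for i h
      by (rule Suc.IH[OF alternating_diff[OF Suc.prems(1) i]])
         (simp add: Suc.prems(2) pos_cone_shift i)
  qed
qed simp

lemma alternating_Suc: "alternating I (Suc k) f \<Longrightarrow> alternating I k f"
proof (induction k arbitrary: f)
  case (Suc k)
  show ?case
    by (rule alternating_SucI)
       (rule alternating_nonneg[OF Suc.prems] Suc.IH[OF alternating_diff[OF Suc.prems]]; assumption)+
qed simp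

lemma shift_commute: "shift i h (shift j h' x) = shift j h' (shift i h x)"
  by (auto simp: fun_eq_iff shift_def)

lemma alternating_shift:
  assumes "alternating I k f" "i \<in> I" "0 < h"
  shows "alternating I k (\<lambda>x. f (shift i h x))"
  using assms(1)
proof (induction k arbitrary: f)
  case 0
  then show ?case by (simp add: pos_cone_shift assms(2,3))
next
  case (Suc k)
  show ?case
  proof (rule alternating_SucI)
    show "0 \<le> f (shift i h x)" if "x \<in> pos_cone I" for x
      by (rule alternating_nonneg[OF Suc.prems pos_cone_shift[OF that assms(2,3)]])
    show "alternating I k (\<lambda>x. f (shift i h x) - f (shift i h (shift j h' x)))"
      if "j \<in> I" "0 < h'" for j h'
      unfolding shift_commute[of i h] by (rule Suc.IH[OF alternating_diff[OF Suc.prems that]])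
  qed
qed

lemma alternating_add:
  assumes "alternating I k f" "alternating I k g"
  shows "alternating I k (\<lambda>x. f x + g x)"
  using assms
proof (induction k arbitrary: f g)
  case (Suc k)
  show ?case
  proof (rule alternating_SucI)
    show "0 \<le> f x + g x" if "x \<in> pos_cone I" for x
      using Suc.prems[THEN alternating_nonneg, OF that] by simp
    show "alternating I k (\<lambda>x. (f x + g x) - (f (shift i h x) + g (shift i h x)))"
      if "i \<in> I" "0 < h" for i h
      unfolding add_diff_add by (rule Suc.IH[OF Suc.prems[THEN alternating_diff, OF that]])
  qed
qed simp

text \<open>Discrete Leibniz rule: with f', g' the shifted functions, f g - f' g' = (f - f') g + f'
  (g - g'). Both summands are products of functions that alternate to order k.\<close>

lemma alternating_mult:
  assumes "alternating I k f" "alternating I k g"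
  shows "alternating I k (\<lambda>x. f x * g x)"
  using assms
proof (induction k arbitrary: f g)
  case (Suc k)
  show ?case
  proof (rule alternating_SucI)
    show "0 \<le> f x * g x" if "x \<in> pos_cone I" for x
      using Suc.prems[THEN alternating_nonneg, OF that] by simp
    fix i and h :: real assume i: "i \<in> I" "0 < h"
    have "alternating I k (\<lambda>x. (f x - f (shift i h x)) * g x)"
      by (rule Suc.IH[OF alternating_diff[OF Suc.prems(1) i] alternating_Suc[OF Suc.prems(2)]])
    moreover have "alternating I k (\<lambda>x. f (shift i h x) * (g x - g (shift i h x)))"
      by (rule Suc.IH[OF alternating_shift[OF alternating_Suc[OF Suc.prems(1)] i]
          alternating_diff[OF Suc.prems(2) i]])
    ultimately have "alternating I k (\<lambda>x. (f x - f (shift i h x)) * g x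
        + f (shift i h x) * (g x - g (shift i h x)))"
      by (rule alternating_add)
    then show "alternating I k (\<lambda>x. f x * g x - f (shift i h x) * g (shift i h x))"
      by (rule alternating_cong) (simp add: algebra_simps)
  qed
qed simp

lemma alternating_const: "0 \<le> c \<Longrightarrow> alternating I k (\<lambda>x. c)"
  by (induction k arbitrary: c) simp_all

text \<open>A difference is a finite linear combination of values, so it commutes with pointwise
  limits; no uniformity of the convergence is involved.\<close>

lemma alternating_limit:
  assumes "\<And>n. alternating I k (F n)"
    and "\<And>x. x \<in> pos_cone I \<Longrightarrow> (\<lambda>n. F n x) \<longlonglongrightarrow> f x"
  shows "alternating I k f"
  using assms
proof (induction k arbitrary: F f)
  case 0
  have "0 \<le> f x" if "x \<in> pos_cone I" for x
    by (rule LIMSEQ_le_const[OF 0(2)[OF that]]) (use 0(1) that in simp)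
  then show ?case by simp
next
  case (Suc k)
  show ?case
  proof (rule alternating_SucI)
    show "0 \<le> f x" if "x \<in> pos_cone I" for x
      by (rule LIMSEQ_le_const[OF Suc.prems(2)[OF that]])
         (use alternating_nonneg[OF Suc.prems(1) that] in simp)
    show "alternating I k (\<lambda>x. f x - f (shift i h x))" if i: "i \<in> I" "0 < h" for i h
      by (rule Suc.IH[where F = "\<lambda>n x. F n x - F n (shift i h x)"])
         (assumption | intro alternating_diff Suc.prems tendsto_diff pos_cone_shift i)+
  qed
qed

text \<open>Differences pass under the integral sign by linearity alone, so mixtures can be treated
  without differentiating under the integral.\<close>

lemma alternating_integral:
  fixes F :: "real \<Rightarrow> ('i \<Rightarrow> real) \<Rightarrow> real"
  assumes "\<And>s. s \<in> S \<Longrightarrow> alternating I k (F s)"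
    and "\<And>x. x \<in> pos_cone I \<Longrightarrow> ((\<lambda>s. F s x) has_integral f x) S"
  shows "alternating I k f"
  using assms
proof (induction k arbitrary: F f)
  case 0
  have "0 \<le> f x" if "x \<in> pos_cone I" for x
    by (rule has_integral_nonneg[OF 0(2)[OF that]]) (use 0(1) that in simp)
  then show ?case by simp
next
  case (Suc k)
  show ?case
  proof (rule alternating_SucI)
    show "0 \<le> f x" if "x \<in> pos_cone I" for x
      by (rule has_integral_nonneg[OF Suc.prems(2)[OF that]])
         (rule alternating_nonneg[OF Suc.prems(1) that])
    show "alternating I k (\<lambda>x. f x - f (shift i h x))" if i: "i \<in> I" "0 < h" for i h
      by (rule Suc.IH[OF alternating_diff[OF Suc.prems(1) i]])
         (assumption | intro has_integral_diff Suc.prems(2) pos_cone_shift i)+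
  qed
qed

text \<open>A difference in direction i with step h only multiplies the exponential by the constant
  \<open>1 - exp (- (c i * h))\<close>, which is nonnegative.\<close>

lemma alternating_exp:
  assumes "finite I" "\<And>i. i \<in> I \<Longrightarrow> 0 \<le> c i"
  shows "alternating I k (\<lambda>x. exp (- (\<Sum>i\<in>I. c i * x i)))"
proof (induction k)
  case (Suc k)
  show ?case
  proof (rule alternating_SucI)
    fix i and h :: real assume i: "i \<in> I" "0 < h"
    have "alternating I k (\<lambda>x. (1 - exp (- (c i * h))) * exp (- (\<Sum>i\<in>I. c i * x i)))"
      using assms i by (intro alternating_mult alternating_const Suc) simp
    moreover have "(\<Sum>j\<in>I. c j * shift i h x j) = (\<Sum>j\<in>I. c j * x j) + c i * h" for x
    proof -
      have "(\<Sum>j\<in>I. c j * shift i h x j) = (\<Sum>j\<in>I. c j * x j + (if j = i then c i * h else 0))"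
        by (intro sum.cong) (simp_all add: shift_def algebra_simps)
      then show ?thesis using assms(1) i by (simp add: sum.distrib)
    qed
    ultimately show "alternating I k (\<lambda>x. exp (- (\<Sum>i\<in>I. c i * x i))
        - exp (- (\<Sum>j\<in>I. c j * shift i h x j)))"
      by (simp only: left_diff_distrib minus_add_distrib exp_add mult_1 mult.commute)
  qed simp
qed simp

text \<open>The negated derivative is the limit of the quotients (f x - f (shift i h x)) / h along h
  = 1/(n+1). Each quotient alternates to order k because f does to order k + 1; this loss of one
  order is why all orders are assumed together.\<close>

lemma fully_alternating_uminus_deriv:
  assumes "fully_alternating I f" "i \<in> I"
    and "\<And>x. x \<in> pos_cone I \<Longrightarrow> (\<lambda>t. f (x(i := t))) field_differentiable at (x i)"
  shows "fully_alternating I (\<lambda>x. - partial_deriv i f x)"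
  unfolding fully_alternating_def
proof
  fix k
  define h :: "nat \<Rightarrow> real" where "h n = inverse (real (Suc n))" for n
  have h: "0 < h n" for n by (simp add: h_def)
  show "alternating I k (\<lambda>x. - partial_deriv i f x)"
  proof (rule alternating_limit)
    show "alternating I k (\<lambda>x. inverse (h n) * (f x - f (shift i (h n) x)))" for n
    proof (intro alternating_mult alternating_const)
      have "alternating I (Suc k) f" using assms(1) unfolding fully_alternating_def by blast
      then show "alternating I k (\<lambda>x. f x - f (shift i (h n) x))"
        using assms(2) h by simp
    qed (use h[of n] in simp)
  next
    fix x assume x: "x \<in> pos_cone I"
    define g where "g t = f (x(i := t))" for t
    have "(g has_field_derivative partial_deriv i f x) (at (x i))"
      using assms(3)[OF x] unfolding partial_deriv_def g_def
      by (simp add: field_differentiable_derivI)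
    then have "((\<lambda>h. (g (x i + h) - g (x i)) / h) \<longlongrightarrow> partial_deriv i f x) (at 0)"
      by (simp add: has_field_derivative_iff LIM_offset_zero_iff DERIV_def)
    moreover have "filterlim h (at 0) sequentially"
      unfolding filterlim_at h_def
      using LIMSEQ_inverse_real_of_nat by auto
    ultimately have "(\<lambda>n. (g (x i + h n) - g (x i)) / h n) \<longlonglongrightarrow> partial_deriv i f x"
      by (rule filterlim_compose)
    then have "(\<lambda>n. - ((g (x i + h n) - g (x i)) / h n)) \<longlonglongrightarrow> - partial_deriv i f x"
      by (rule tendsto_minus)
    moreover have "- ((g (x i + h n) - g (x i)) / h n)
        = inverse (h n) * (f x - f (shift i (h n) x))" for n
      by (simp add: g_def shift_def divide_inverse algebra_simps)
    ultimately show "(\<lambda>n. inverse (h n) * (f x - f (shift i (h n) x)))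
        \<longlonglongrightarrow> - partial_deriv i f x"
      by simp
  qed
qed

lemma fully_alternating_cong:
  assumes "fully_alternating I f" "\<And>x. x \<in> pos_cone I \<Longrightarrow> f x = g x"
  shows "fully_alternating I g"
  using assms alternating_cong unfolding fully_alternating_def by metis

lemma fully_alternating_iter_partial:
  assumes smooth: "smooth_on_cone I f" and f: "fully_alternating I f"
  shows "js \<in> lists I \<Longrightarrow> fully_alternating I (\<lambda>x. (- 1) ^ length js * iter_partial js f x)"
proof (induction js)
  case Nil
  then show ?case using f by (simp add: iter_partial_def)
next
  case (Cons i js)
  have js: "js \<in> lists I" "i \<in> I" using Cons.prems by auto
  let ?g = "iter_partial js f"
  have diff: "(\<lambda>t. ?g (x(i := t))) field_differentiable at (x i)" if "x \<in> pos_cone I" for x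
    using smooth[unfolded smooth_on_cone_def, rule_format, OF js(1)] js(2) that by blast
  have "fully_alternating I (\<lambda>x. - partial_deriv i (\<lambda>x. (- 1) ^ length js * ?g x) x)"
  proof (rule fully_alternating_uminus_deriv[OF Cons.IH js(2)])
    show "(\<lambda>t. (- 1) ^ length js * ?g (x(i := t))) field_differentiable at (x i)"
      if "x \<in> pos_cone I" for x
      by (rule field_differentiable_mult[OF field_differentiable_const diff[OF that]])
  qed (rule js(1))
  moreover have "- partial_deriv i (\<lambda>x. (- 1) ^ length js * ?g x) x
      = (- 1) ^ length (i # js) * iter_partial (i # js) f x" if "x \<in> pos_cone I" for x
    unfolding partial_deriv_def deriv_cmult[OF diff[OF that]]
    by (simp add: iter_partial_def partial_deriv_def)
  ultimately show ?case
    by (rule fully_alternating_cong)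
qed

lemma completely_monotone_if_alternating:
  assumes smooth: "smooth_on_cone I f" and f: "fully_alternating I f"
  shows "completely_monotone I f"
  unfolding completely_monotone_def
proof (intro conjI ballI smooth)
  fix js x assume "js \<in> lists I" "x \<in> pos_cone I"
  then show "0 \<le> (- 1) ^ length js * iter_partial js f x"
    using fully_alternating_iter_partial[OF smooth f, of js]
    unfolding fully_alternating_def by (metis alternating_nonneg)
qed

section \<open>Smoothness\<close>

text \<open>A syntactic class that is closed under partial derivatives up to equality on the cone.
  It contains the real powers of polynomials positive on the cone, so smoothness follows from an
  induction over how the function is built.\<close>

inductive elementary :: "'i set \<Rightarrow> (('i \<Rightarrow> real) \<Rightarrow> real) \<Rightarrow> bool" for I where
  elementary_const: "elementary I (\<lambda>x. c)"
| elementary_coord: "i \<in> I \<Longrightarrow> elementary I (\<lambda>x. x i)"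
| elementary_add: "elementary I f \<Longrightarrow> elementary I g \<Longrightarrow> elementary I (\<lambda>x. f x + g x)"
| elementary_mult: "elementary I f \<Longrightarrow> elementary I g \<Longrightarrow> elementary I (\<lambda>x. f x * g x)"
| elementary_powr: "elementary I f \<Longrightarrow> (\<And>x. x \<in> pos_cone I \<Longrightarrow> 0 < f x) \<Longrightarrow>
    elementary I (\<lambda>x. f x powr c)"

lemma elementary_sum:
  assumes "finite A" "\<And>a. a \<in> A \<Longrightarrow> elementary I (F a)"
  shows "elementary I (\<lambda>x. \<Sum>a\<in>A. F a x)"
  using assms by (induction A) (auto intro: elementary.intros)

lemma elementary_prod:
  assumes "finite A" "\<And>a. a \<in> A \<Longrightarrow> elementary I (F a)"
  shows "elementary I (\<lambda>x. \<Prod>a\<in>A. F a x)"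
  using assms by (induction A) (auto intro: elementary.intros)

lemma elementary_continuous: "elementary I f \<Longrightarrow> continuous_on (pos_cone I) f"
proof (induction rule: elementary.induct)
  case (elementary_powr f c)
  then show ?case by (intro continuous_intros) force+
next
  case (elementary_coord i)
  show ?case by (rule continuous_on_subset[OF continuous_on_product_coordinates]) simp
qed (intro continuous_intros; assumption)+

lemma elementary_partial:
  assumes "elementary I f" "i \<in> I"
  shows "\<exists>f'. elementary I f' \<and>
    (\<forall>x\<in>pos_cone I. ((\<lambda>t. f (x(i := t))) has_real_derivative f' x) (at (x i)))"
  using assms(1)
proof (induction rule: elementary.induct)
  case (elementary_const c)
  then show ?case by (intro exI[of _ "\<lambda>x. 0"]) (auto intro: elementary.intros)
next
  case (elementary_coord j)
  then show ?case
    by (intro exI[of _ "\<lambda>x. if j = i then 1 else 0"])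
       (auto intro: elementary.intros)
next
  case (elementary_add f g)
  then obtain f' g' where "elementary I f'" "elementary I g'"
    "\<forall>x\<in>pos_cone I. ((\<lambda>t. f (x(i := t))) has_real_derivative f' x) (at (x i))"
    "\<forall>x\<in>pos_cone I. ((\<lambda>t. g (x(i := t))) has_real_derivative g' x) (at (x i))" by blast
  then show ?case
    by (intro exI[of _ "\<lambda>x. f' x + g' x"] conjI ballI elementary.elementary_add DERIV_add) blast+
next
  case (elementary_mult f g)
  then obtain f' g' where fg: "elementary I f'" "elementary I g'"
    "\<forall>x\<in>pos_cone I. ((\<lambda>t. f (x(i := t))) has_real_derivative f' x) (at (x i))"
    "\<forall>x\<in>pos_cone I. ((\<lambda>t. g (x(i := t))) has_real_derivative g' x) (at (x i))" by blast
  have "((\<lambda>t. f (x(i := t)) * g (x(i := t))) has_real_derivative f' x * g x + g' x * f x) (at (x i))"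
    if "x \<in> pos_cone I" for x
    using DERIV_mult[OF fg(3)[rule_format, OF that] fg(4)[rule_format, OF that]] by simp
  then show ?case using fg(1,2) elementary_mult.hyps
    by (intro exI[of _ "\<lambda>x. f' x * g x + g' x * f x"] conjI ballI
        elementary.elementary_mult elementary.elementary_add) blast+
next
  case (elementary_powr f c)
  then obtain f' where f': "elementary I f'"
    "\<forall>x\<in>pos_cone I. ((\<lambda>t. f (x(i := t))) has_real_derivative f' x) (at (x i))" by blast
  have "((\<lambda>t. f (x(i := t)) powr c) has_real_derivative c * f x powr (c - 1) * f' x) (at (x i))"
    if "x \<in> pos_cone I" for x
    using DERIV_fun_powr[OF f'(2)[rule_format, OF that], of c] elementary_powr.hyps(2)[OF that]
    by simp
  then show ?case using f'(1) elementary_powr.hyps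
    by (intro exI[of _ "\<lambda>x. c * f x powr (c - 1) * f' x"] conjI ballI
        elementary.elementary_mult elementary.elementary_powr elementary.elementary_const) blast+
qed

lemma elementary_iter_partial:
  assumes "elementary I f" "is \<in> lists I"
  shows "\<exists>g. elementary I g \<and> (\<forall>x\<in>pos_cone I. iter_partial is f x = g x)"
  using assms(2)
proof (induction "is")
  case Nil
  then show ?case using assms(1) by (auto simp: iter_partial_def)
next
  case (Cons i js)
  then obtain g where g: "elementary I g" "\<And>x. x \<in> pos_cone I \<Longrightarrow> iter_partial js f x = g x"
    by auto
  have i: "i \<in> I" using Cons.hyps by simp
  from elementary_partial[OF g(1) i] obtain g' where g': "elementary I g'"
    "\<And>x. x \<in> pos_cone I \<Longrightarrow> ((\<lambda>t. g (x(i := t))) has_real_derivative g' x) (at (x i))"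
    by auto
  have "iter_partial (i # js) f x = g' x" if x: "x \<in> pos_cone I" for x
  proof -
    \<comment> \<open>The iterated derivative is known to agree with g only on the cone. Since x i
      is positive, changing coordinate i slightly stays in the cone, and \<open>deriv\<close> sees
      only values near x i.\<close>
    have "\<forall>\<^sub>F t in nhds (x i). 0 < t"
      using x i by (intro eventually_nhds_in_open[of "{0<..}", simplified]) (auto dest: pos_coneD)
    then have "\<forall>\<^sub>F t in nhds (x i). iter_partial js f (x(i := t)) = g (x(i := t))"
      by (rule eventually_mono) (use x i in \<open>auto intro!: g(2) pos_cone_upd\<close>)
    then have "partial_deriv i (iter_partial js f) x = deriv (\<lambda>t. g (x(i := t))) (x i)"
      unfolding partial_deriv_def by (intro deriv_cong_ev) auto
    also have "\<dots> = g' x" by (rule DERIV_imp_deriv[OF g'(2)[OF x]])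
    finally show ?thesis by (simp add: iter_partial_def)
  qed
  with g'(1) show ?case by blast
qed

lemma elementary_smooth:
  assumes "elementary I f"
  shows "smooth_on_cone I f"
  unfolding smooth_on_cone_def
proof (intro ballI conjI)
  fix "is" assume "is \<in> lists I"
  from elementary_iter_partial[OF assms this] obtain g where g: "elementary I g"
    "\<And>x. x \<in> pos_cone I \<Longrightarrow> iter_partial is f x = g x" by blast
  show "continuous_on (pos_cone I) (iter_partial is f)"
    using elementary_continuous[OF g(1)] g(2) by (simp cong: continuous_on_cong)
  fix x i assume x: "x \<in> pos_cone I" and i: "i \<in> I"
  from elementary_partial[OF g(1) i] x
  have diff: "(\<lambda>t. g (x(i := t))) field_differentiable at (x i)"
    unfolding field_differentiable_def by blast
  have "\<forall>\<^sub>F t in nhds (x i). 0 < t"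
    using x i by (intro eventually_nhds_in_open[of "{0<..}", simplified]) (auto dest: pos_coneD)
  then have "\<forall>\<^sub>F t in nhds (x i). iter_partial is f (x(i := t)) = g (x(i := t))"
    by (rule eventually_mono) (use x i in \<open>auto intro!: g(2) pos_cone_upd\<close>)
  then show "(\<lambda>t. iter_partial is f (x(i := t))) field_differentiable at (x i)"
    using diff DERIV_cong_ev[OF refl _ refl, of "\<lambda>t. iter_partial is f (x(i := t))"]
    unfolding field_differentiable_def by metis
qed

section \<open>Gaussian and Gamma mixtures\<close>

text \<open>Completing the square, a u^2 + 2 b u + c = a (u + b/a)^2 + c - b^2/a, which exhibits a
  multiple of the normal density with mean -b/a and variance 1/(2a).\<close>

lemma has_integral_gaussian:
  fixes a b c :: real
  assumes "0 < a"
  shows "((\<lambda>u. exp (- (a * u\<^sup>2 + 2 * b * u + c))) has_integral sqrt (pi / a) * exp (b\<^sup>2 / a - c)) UNIV"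
proof -
  define \<sigma> where "\<sigma> = sqrt (1 / (2 * a))"
  have \<sigma>: "0 < \<sigma>" "\<sigma>\<^sup>2 = 1 / (2 * a)" using assms by (simp_all add: \<sigma>_def)
  have "(normal_density (- b / a) \<sigma> has_integral 1) UNIV"
    using has_integral_integral_lborel[OF integrable_normal_density[OF \<sigma>(1), of "- b / a"]]
      integral_normal_density[OF \<sigma>(1)] by simp
  then have "((\<lambda>u. (sqrt (pi / a) * exp (b\<^sup>2 / a - c)) * normal_density (- b / a) \<sigma> u)
      has_integral (sqrt (pi / a) * exp (b\<^sup>2 / a - c)) * 1) UNIV"
    by (rule has_integral_mult_right)
  moreover have "(sqrt (pi / a) * exp (b\<^sup>2 / a - c)) * normal_density (- b / a) \<sigma> u
      = exp (- (a * u\<^sup>2 + 2 * b * u + c))" for u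
  proof -
    have "2 * pi * \<sigma>\<^sup>2 = pi / a" using assms \<sigma> by simp
    moreover have "- (u - (- b / a))\<^sup>2 / (2 * \<sigma>\<^sup>2) = - (a * u\<^sup>2 + 2 * b * u + c) - (b\<^sup>2 / a - c)"
      using assms unfolding \<sigma>(2) by (simp add: field_simps power2_eq_square)
    ultimately show ?thesis
      using assms by (simp add: normal_density_def flip: exp_add)
  qed
  ultimately show ?thesis by simp
qed

text \<open>Euler's integral for \<open>Gamma s\<close> after the substitution of c t for t;
  multiplying by \<open>c powr (1 - s)\<close> removes the power of c that the substitution puts
  into the integrand.\<close>

lemma has_integral_Gamma_scaled:
  fixes c s :: real
  assumes "0 < s" "0 < c"
  shows "((\<lambda>t. t powr (s - 1) * exp (- (c * t))) has_integral Gamma s * c powr (- s)) {0..}"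
proof -
  let ?f = "\<lambda>t. indicator {0..} t * t powr (s - 1) / exp t :: real"
  have "has_bochner_integral lborel ?f (Gamma s)"
    using assms Gamma_conv_nn_integral_real[of s]
    by (intro has_bochner_integral_nn_integral) (auto simp: Gamma_real_pos less_imp_le)
  then have "has_bochner_integral lborel (\<lambda>t. ?f (0 + c * t)) (Gamma s /\<^sub>R \<bar>c\<bar>)"
    using assms by (subst lborel_has_bochner_integral_real_affine_iff[symmetric]) auto
  then have "((\<lambda>t. ?f (c * t)) has_integral Gamma s / c) UNIV"
    using has_integral_integral_lborel[of "\<lambda>t. ?f (c * t)"] assms
    by (simp add: has_bochner_integral_iff divide_inverse mult.commute)
  then have "((\<lambda>t. c powr (1 - s) * ?f (c * t)) has_integral c powr (1 - s) * (Gamma s / c)) UNIV"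
    by (rule has_integral_mult_right)
  moreover have "c powr (1 - s) * ?f (c * t)
      = (if t \<in> {0..} then t powr (s - 1) * exp (- (c * t)) else 0)" for t
  proof (cases "0 \<le> t")
    case True
    have "c powr (1 - s) * c powr (s - 1) = 1"
      using assms by (simp add: powr_add[symmetric])
    with True show ?thesis
      using assms by (simp add: powr_mult exp_minus divide_inverse)
  next
    case False
    with assms show ?thesis by (simp add: indicator_def zero_le_mult_iff)
  qed
  moreover have "c powr (1 - s) * (Gamma s / c) = Gamma s * c powr (- s)"
    using assms by (simp add: powr_diff powr_minus divide_inverse)
  ultimately have "((\<lambda>t. if t \<in> {0..} then t powr (s - 1) * exp (- (c * t)) else 0)
      has_integral Gamma s * c powr (- s)) UNIV" by (simp only:)
  then show ?thesis by (simp only: has_integral_restrict_UNIV)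
qed

section \<open>Closure of full alternation under products and mixtures\<close>

lemma fully_alternating_mult:
  "fully_alternating I f \<Longrightarrow> fully_alternating I g \<Longrightarrow> fully_alternating I (\<lambda>x. f x * g x)"
  unfolding fully_alternating_def by (intro allI alternating_mult) simp_all

lemma fully_alternating_cmult:
  "0 \<le> c \<Longrightarrow> fully_alternating I f \<Longrightarrow> fully_alternating I (\<lambda>x. c * f x)"
  unfolding fully_alternating_def by (intro allI alternating_mult alternating_const) simp_all

text \<open>The positive factor c absorbs normalising constants such as sqrt pi or a Gamma
  value.\<close>

lemma fully_alternating_integral:
  fixes F :: "real \<Rightarrow> ('i \<Rightarrow> real) \<Rightarrow> real"
  assumes "\<And>s. s \<in> S \<Longrightarrow> fully_alternating I (F s)"
    and "\<And>x. x \<in> pos_cone I \<Longrightarrow> ((\<lambda>s. F s x) has_integral c * f x) S" and "0 < c"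
  shows "fully_alternating I f"
proof (rule fully_alternating_cong)
  have "fully_alternating I (\<lambda>x. c * f x)"
    unfolding fully_alternating_def
  proof
    show "alternating I k (\<lambda>x. c * f x)" for k
      using assms(1) by (intro alternating_integral[OF _ assms(2)]) (simp add: fully_alternating_def)
  qed
  then show "fully_alternating I (\<lambda>x. inverse c * (c * f x))"
    by (rule fully_alternating_cmult[rotated]) (use assms(3) in simp)
qed (use assms(3) in simp)

lemma fully_alternating_exp:
  assumes "finite I" "J \<subseteq> I" "\<And>j. j \<in> J \<Longrightarrow> 0 \<le> c j"
  shows "fully_alternating I (\<lambda>x. exp (- (\<Sum>j\<in>J. c j * x j)))"
proof -
  have "(\<Sum>j\<in>J. c j * x j) = (\<Sum>i\<in>I. (if i \<in> J then c i else 0) * x i)" for x :: "'a \<Rightarrow> real"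
    using assms(1,2) by (intro sum.mono_neutral_cong_left) auto
  then show ?thesis
    using assms alternating_exp[of I "\<lambda>i. if i \<in> J then c i else 0"]
    unfolding fully_alternating_def by simp
qed

lemma sum_pos_cone:
  "finite J \<Longrightarrow> J \<noteq> {} \<Longrightarrow> J \<subseteq> I \<Longrightarrow> x \<in> pos_cone I \<Longrightarrow> 0 < (\<Sum>j\<in>J. x j)"
  by (intro sum_pos) (auto dest: pos_coneD)

text \<open>A negative power of a linear form is a Gamma mixture of exponentials of that
  form.\<close>

lemma fully_alternating_sum_powr:
  assumes "finite I" "J \<subseteq> I" "J \<noteq> {}" "0 < s"
  shows "fully_alternating I (\<lambda>x. (\<Sum>j\<in>J. x j) powr (- s))"
proof (rule fully_alternating_integral)
  show "fully_alternating I (\<lambda>x. t powr (s - 1) * exp (- (\<Sum>j\<in>J. t * x j)))" if "t \<in> {0..}" for t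
    using that assms by (intro fully_alternating_cmult fully_alternating_exp) auto
  show "((\<lambda>t. t powr (s - 1) * exp (- (\<Sum>j\<in>J. t * x j)))
      has_integral Gamma s * (\<Sum>j\<in>J. x j) powr (- s)) {0..}" if "x \<in> pos_cone I" for x
    using has_integral_Gamma_scaled[OF assms(4) sum_pos_cone[OF _ assms(3,2) that]]
      finite_subset[OF assms(2,1)]
    by (simp add: sum_distrib_left[symmetric] mult.commute)
qed (use assms in simp)

lemma sqrt_pi_divide: "0 < a \<Longrightarrow> sqrt (pi / a) = sqrt pi * a powr (- 1/2)"
  by (simp add: real_sqrt_divide powr_minus_divide powr_half_sqrt)

text \<open>Star-triangle transformation as a Gaussian integral. The points p j are joined by
  springs of strength x j to a centre u; integrating \<open>exp\<close> of minus the energy over u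
  leaves the minimal energy in the exponent and, up to sqrt pi, the total strength to the power
  -1/2.\<close>

lemma fully_alternating_star:
  fixes p :: "'i \<Rightarrow> real"
  assumes "finite I" "J \<subseteq> I" "J \<noteq> {}"
  shows "fully_alternating I (\<lambda>x. (\<Sum>j\<in>J. x j) powr (- 1/2) *
    exp (- ((\<Sum>j\<in>J. x j * (p j)\<^sup>2) - (\<Sum>j\<in>J. x j * p j)\<^sup>2 / (\<Sum>j\<in>J. x j))))"
proof (rule fully_alternating_integral)
  show "fully_alternating I (\<lambda>x. exp (- (\<Sum>j\<in>J. (p j - u)\<^sup>2 * x j)))" for u
    using assms by (intro fully_alternating_exp) auto
  fix x assume x: "x \<in> pos_cone I"
  let ?S = "\<Sum>j\<in>J. x j" and ?M = "\<Sum>j\<in>J. x j * p j" and ?E = "\<Sum>j\<in>J. x j * (p j)\<^sup>2"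
  have S: "0 < ?S" by (rule sum_pos_cone[OF finite_subset[OF assms(2,1)] assms(3,2) x])
  have expand: "(\<Sum>j\<in>J. (p j - u)\<^sup>2 * x j) = ?S * u\<^sup>2 + 2 * (- ?M) * u + ?E" for u
  proof -
    have "(p j - u)\<^sup>2 * x j = x j * u\<^sup>2 + x j * p j * (- 2 * u) + x j * (p j)\<^sup>2" for j
      by (simp add: power2_eq_square algebra_simps)
    then have "(\<Sum>j\<in>J. (p j - u)\<^sup>2 * x j) = ?S * u\<^sup>2 + ?M * (- 2 * u) + ?E"
      by (simp only: sum.distrib sum_distrib_right)
    then show ?thesis by (simp only: mult_minus_right mult_minus_left mult_ac)
  qed
  have "((\<lambda>u. exp (- (\<Sum>j\<in>J. (p j - u)\<^sup>2 * x j))) has_integral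
      sqrt (pi / ?S) * exp ((- ?M)\<^sup>2 / ?S - ?E)) UNIV"
    unfolding expand by (rule has_integral_gaussian[OF S])
  then show "((\<lambda>u. exp (- (\<Sum>j\<in>J. (p j - u)\<^sup>2 * x j))) has_integral
      sqrt pi * (?S powr (- 1/2) * exp (- (?E - ?M\<^sup>2 / ?S)))) UNIV"
    by (simp only: sqrt_pi_divide[OF S] minus_diff_eq power2_minus mult.assoc)
qed simp

text \<open>The Bartlett decomposition of the Wishart distribution: a positive semidefinite
  \<open>2 \<times> 2\<close> matrix is the Gram matrix of \<open>(r, 0)\<close> and \<open>(u, v)\<close>; below \<open>s = r\<^sup>2\<close>, \<open>t = v\<^sup>2\<close>.\<close>

lemma fully_alternating_det_powr:
  assumes \<beta>: "1/2 < \<beta>"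
    and pos: "\<And>x. x \<in> pos_cone I \<Longrightarrow> 0 < Z x"
      "\<And>x. x \<in> pos_cone I \<Longrightarrow> 0 < X x * Z x - (Y x)\<^sup>2"
    and F: "\<And>r u v. fully_alternating I (\<lambda>x. W x *
      exp (- (X x * r\<^sup>2 + 2 * Y x * r * u + Z x * u\<^sup>2)) * exp (- (Z x * v\<^sup>2)))"
  shows "fully_alternating I (\<lambda>x. W x * (X x * Z x - (Y x)\<^sup>2) powr (- \<beta>))"
proof -
  define D where "D x = X x * Z x - (Y x)\<^sup>2" for x
  have D: "0 < D x / Z x" if "x \<in> pos_cone I" for x
    using pos[OF that] by (simp add: D_def)
  \<comment> \<open>Integrating out u replaces X by the Schur complement X - Y^2 / Z = D / Z and
    produces the factor Z to the power -1/2.\<close>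
  have F1: "fully_alternating I (\<lambda>x. W x * Z x powr (- 1/2) * exp (- (D x / Z x * s)) * exp (- (Z x * t)))"
    if "0 \<le> s" "0 \<le> t" for s t
  proof (rule fully_alternating_integral[OF F[of "sqrt s" _ "sqrt t"]])
    fix x assume x: "x \<in> pos_cone I"
    have "((\<lambda>u. exp (- (Z x * u\<^sup>2 + 2 * (Y x * sqrt s) * u + X x * s)))
        has_integral sqrt (pi / Z x) * exp ((Y x * sqrt s)\<^sup>2 / Z x - X x * s)) UNIV"
      by (rule has_integral_gaussian[OF pos(1)[OF x]])
    moreover have "(Y x * sqrt s)\<^sup>2 / Z x - X x * s = - (D x / Z x * s)"
      using pos(1)[OF x] that by (simp add: D_def power_mult_distrib field_simps)
    moreover have "sqrt (pi / Z x) = sqrt pi * Z x powr (- 1/2)"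
      by (rule sqrt_pi_divide[OF pos(1)[OF x]])
    ultimately have "((\<lambda>u. W x * exp (- (Z x * t)) * exp (- (Z x * u\<^sup>2 + 2 * (Y x * sqrt s) * u + X x * s)))
        has_integral W x * exp (- (Z x * t)) * (sqrt pi * Z x powr (- 1/2) * exp (- (D x / Z x * s)))) UNIV"
      by (intro has_integral_mult_right) simp
    then show "((\<lambda>u. W x * exp (- (X x * (sqrt s)\<^sup>2 + 2 * Y x * sqrt s * u + Z x * u\<^sup>2)) *
        exp (- (Z x * (sqrt t)\<^sup>2))) has_integral
        sqrt pi * (W x * Z x powr (- 1/2) * exp (- (D x / Z x * s)) * exp (- (Z x * t)))) UNIV"
      using that by (simp add: mult_ac add_ac)
  qed simp
  \<comment> \<open>The Gamma weight in t has shape \<beta> - 1/2, positive by assumption; it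
    supplies the missing power of Z, since 1/2 + (\<beta> - 1/2) = \<beta>.\<close>
  have F2: "fully_alternating I (\<lambda>x. W x * Z x powr (- \<beta>) * exp (- (D x / Z x * s)))"
    if s: "0 \<le> s" for s
  proof (rule fully_alternating_integral)
    let ?F = "\<lambda>t x. t powr (\<beta> - 1/2 - 1) *
      (W x * Z x powr (- 1/2) * exp (- (D x / Z x * s)) * exp (- (Z x * t)))"
    show "fully_alternating I (?F t)" if "t \<in> {0..}" for t
      using that s by (intro fully_alternating_cmult F1) auto
    fix x assume x: "x \<in> pos_cone I"
    have "((\<lambda>t. t powr (\<beta> - 1/2 - 1) * exp (- (Z x * t)))
        has_integral Gamma (\<beta> - 1/2) * Z x powr (- (\<beta> - 1/2))) {0..}"
      using \<beta> by (intro has_integral_Gamma_scaled pos(1) x) simp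
    then have "((\<lambda>t. W x * Z x powr (- 1/2) * exp (- (D x / Z x * s)) *
        (t powr (\<beta> - 1/2 - 1) * exp (- (Z x * t))))
        has_integral W x * Z x powr (- 1/2) * exp (- (D x / Z x * s)) *
        (Gamma (\<beta> - 1/2) * Z x powr (- (\<beta> - 1/2)))) {0..}"
      by (rule has_integral_mult_right)
    moreover have "Z x powr (- 1/2) * Z x powr (- (\<beta> - 1/2)) = Z x powr (- \<beta>)"
      by (simp add: powr_add[symmetric])
    ultimately show "((\<lambda>t. ?F t x) has_integral
        Gamma (\<beta> - 1/2) * (W x * Z x powr (- \<beta>) * exp (- (D x / Z x * s)))) {0..}"
      by (simp add: mult_ac)
  qed (use \<beta> in simp)
  \<comment> \<open>The last weight, in s, has shape \<beta> and yields (D / Z) to the power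
    -\<beta>, whose Z cancels against the one already collected.\<close>
  have "fully_alternating I (\<lambda>x. W x * D x powr (- \<beta>))"
  proof (rule fully_alternating_integral)
    let ?F = "\<lambda>s x. s powr (\<beta> - 1) * (W x * Z x powr (- \<beta>) * exp (- (D x / Z x * s)))"
    show "fully_alternating I (?F s)" if "s \<in> {0..}" for s
      using that by (intro fully_alternating_cmult F2) auto
    fix x assume x: "x \<in> pos_cone I"
    have "((\<lambda>s. s powr (\<beta> - 1) * exp (- (D x / Z x * s)))
        has_integral Gamma \<beta> * (D x / Z x) powr (- \<beta>)) {0..}"
      using \<beta> by (intro has_integral_Gamma_scaled D x) simp
    then have "((\<lambda>s. W x * Z x powr (- \<beta>) * (s powr (\<beta> - 1) * exp (- (D x / Z x * s))))
        has_integral W x * Z x powr (- \<beta>) * (Gamma \<beta> * (D x / Z x) powr (- \<beta>))) {0..}"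
      by (rule has_integral_mult_right)
    moreover have "Z x powr (- \<beta>) * (D x / Z x) powr (- \<beta>) = D x powr (- \<beta>)"
      using pos[OF x] D[OF x] by (simp add: powr_mult[symmetric])
    ultimately show "((\<lambda>s. ?F s x) has_integral Gamma \<beta> * (W x * D x powr (- \<beta>))) {0..}"
      by (simp add: mult_ac)
  qed (use \<beta> in simp)
  then show ?thesis unfolding D_def .
qed

section \<open>Trees and cuts\<close>

text \<open>Trees on W in constructive form, one leaf attached at a time. They serve to trade the
  search for cycles in the definition of a tree for a count of edges.\<close>

inductive grown :: "'a set \<Rightarrow> 'a set set \<Rightarrow> bool" where
  grown_single: "grown {v} {}"
| grown_leaf: "grown W T \<Longrightarrow> u \<in> W \<Longrightarrow> v \<notin> W \<Longrightarrow> grown (insert v W) (insert {u, v} T)"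

abbreviation adj :: "'a set set \<Rightarrow> ('a \<times> 'a) set" where
  "adj T \<equiv> {(a, b). {a, b} \<in> T}"

lemma grown_finite:
  "grown W T \<Longrightarrow> finite W \<and> finite T \<and> W \<noteq> {} \<and> T \<subseteq> Pow W \<and> card W = card T + 1"
proof (induction rule: grown.induct)
  case (grown_leaf W T u v)
  then have "{u, v} \<notin> T" by auto
  with grown_leaf show ?case by auto
qed simp

text \<open>Simple paths are needed because such a path, closed up by one further edge, is a
  cycle.\<close>

lemma grown_path:
  "grown W T \<Longrightarrow> x \<in> W \<Longrightarrow> y \<in> W \<Longrightarrow>
    \<exists>vs. vs \<noteq> [] \<and> hd vs = x \<and> last vs = y \<and> distinct vs \<and> set vs \<subseteq> W \<and>
      successively (\<lambda>a b. {a, b} \<in> T) vs"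
proof (induction arbitrary: x y rule: grown.induct)
  case (grown_single v)
  then show ?case by (intro exI[of _ "[v]"]) simp
next
  case (grown_leaf W T u v)
  have path: "\<exists>vs. vs \<noteq> [] \<and> hd vs = x \<and> last vs = y \<and> distinct vs \<and> set vs \<subseteq> W \<and>
      successively (\<lambda>a b. {a, b} \<in> insert {u, v} T) vs" if xy: "x \<in> W" "y \<in> W" for x y
  proof -
    from grown_leaf.IH[OF xy] obtain vs where vs: "vs \<noteq> []" "hd vs = x" "last vs = y"
      "distinct vs" "set vs \<subseteq> W" "successively (\<lambda>a b. {a, b} \<in> T) vs" by blast
    then show ?thesis
      by (intro exI[of _ vs]) (auto elim: successively_mono)
  qed
  consider "x \<in> W" "y \<in> W" | "x = v" "y = v" | "x \<in> W" "y = v" | "x = v" "y \<in> W"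
    using grown_leaf.prems by auto
  then show ?case
  proof cases
    case 1
    from path[OF this] show ?thesis by blast
  next
    case 2
    then show ?thesis by (intro exI[of _ "[v]"]) simp
  next
    case 3
    from path[OF 3(1) grown_leaf.hyps(2)] obtain vs where vs: "vs \<noteq> []" "hd vs = x" "last vs = u"
      "distinct vs" "set vs \<subseteq> W" "successively (\<lambda>a b. {a, b} \<in> insert {u, v} T) vs" by blast
    with 3 grown_leaf.hyps(3) show ?thesis
      by (intro exI[of _ "vs @ [v]"]) (auto simp: successively_append_iff)
  next
    case 4
    from path[OF grown_leaf.hyps(2) 4(2)] obtain vs where vs: "vs \<noteq> []" "hd vs = u" "last vs = y"
      "distinct vs" "set vs \<subseteq> W" "successively (\<lambda>a b. {a, b} \<in> insert {u, v} T) vs" by blast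
    with 4 grown_leaf.hyps(3) show ?thesis
      by (intro exI[of _ "v # vs"]) (auto simp: successively_Cons insert_commute)
  qed
qed

text \<open>The last attached leaf v has u as its only neighbour, so a cycle through v would visit u
  twice; a cycle avoiding v already lies in the smaller tree.\<close>

lemma grown_acyclic: "grown W T \<Longrightarrow> \<not> ug_cycle (V, T) vs"
proof (induction rule: grown.induct)
  case (grown_single v)
  then show ?case by (auto simp: ug_cycle_def intro: exI[of _ 0])
next
  case (grown_leaf W T u v)
  have T: "{v, w} \<notin> T" for w using grown_finite[OF grown_leaf.hyps(1)] grown_leaf.hyps(3) by blast
  show ?case
  proof
    assume c: "ug_cycle (V, insert {u, v} T) vs"
    let ?n = "length vs"
    have n: "3 \<le> ?n" and dist: "distinct vs" and
      edge: "\<And>i. i < ?n \<Longrightarrow> {vs ! i, vs ! (Suc i mod ?n)} \<in> insert {u, v} T"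
      using c unfolding ug_cycle_def by auto
    show False
    proof (cases "v \<in> set vs")
      case False
      have "{vs ! i, vs ! (Suc i mod ?n)} \<in> T" if "i < ?n" for i
      proof -
        have "Suc i mod ?n < ?n" using n by (intro mod_less_divisor) linarith
        then have "vs ! i \<noteq> v" "vs ! (Suc i mod ?n) \<noteq> v" using False that nth_mem by metis+
        then have "{vs ! i, vs ! (Suc i mod ?n)} \<noteq> {u, v}" by (auto simp: doubleton_eq_iff)
        then show ?thesis using edge[OF that] by blast
      qed
      with n dist have "ug_cycle (V, T) vs" by (simp add: ug_cycle_def)
      with grown_leaf.IH show False by contradiction
    next
      case True
      then obtain i where i: "i < ?n" "vs ! i = v" by (metis in_set_conv_nth)
      \<comment> \<open>j and k are the cyclic predecessor and successor of position i; they differ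
        because a cycle has at least three vertices.\<close>
      define j where "j = (if i = 0 then ?n - 1 else i - 1)"
      define k where "k = (if i = ?n - 1 then 0 else i + 1)"
      have j: "j < ?n" "Suc j mod ?n = i" and k: "k < ?n" "Suc i mod ?n = k" "j \<noteq> k"
        using i n unfolding j_def k_def by (cases "length vs"; auto)+
      have nbr: "w = u" if "{v, w} \<in> insert {u, v} T" for w
        using that T[of w] grown_leaf.hyps by (auto simp: doubleton_eq_iff)
      have "vs ! k = u" using edge[OF i(1)] i k nbr by simp
      moreover have "vs ! j = u" using edge[OF j(1)] i j nbr by (simp add: insert_commute)
      ultimately show False using dist j k by (metis nth_eq_iff_index_eq)
    qed
  qed
qed

lemma rtrancl_crossing:
  assumes "(x, y) \<in> R\<^sup>*" "x \<in> W" "y \<notin> W"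
  shows "\<exists>a b. (a, b) \<in> R \<and> a \<in> W \<and> b \<notin> W"
  using assms by (induction rule: rtrancl_induct) auto

text \<open>For the converse, the set of vertices reachable from x would be a cut crossed by no
  edge. Unlike reachability, the condition on cuts can be evaluated directly for a concrete
  graph.\<close>

lemma ug_connected_iff_cuts:
  assumes "T \<subseteq> Pow V"
  shows "ug_connected (V, T) \<longleftrightarrow> V \<noteq> {} \<and>
    (\<forall>W\<subseteq>V. W \<noteq> {} \<longrightarrow> W \<noteq> V \<longrightarrow> (\<exists>u\<in>W. \<exists>v\<in>V - W. {u, v} \<in> T))"
proof (intro iffI conjI allI impI)
  assume "ug_connected (V, T)"
  then show "V \<noteq> {}" by (simp add: ug_connected_def)
next
  fix W assume con: "ug_connected (V, T)" and W: "W \<subseteq> V" "W \<noteq> {}" "W \<noteq> V"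
  then obtain x y where xy: "x \<in> W" "y \<in> V" "y \<notin> W" by blast
  with con W have "(x, y) \<in> (adj T)\<^sup>*" by (auto simp: ug_connected_def)
  from rtrancl_crossing[OF this xy(1,3)] obtain a b where "{a, b} \<in> T" "a \<in> W" "b \<notin> W" by auto
  with assms show "\<exists>u\<in>W. \<exists>v\<in>V - W. {u, v} \<in> T" by blast
next
  assume cuts: "V \<noteq> {} \<and>
    (\<forall>W\<subseteq>V. W \<noteq> {} \<longrightarrow> W \<noteq> V \<longrightarrow> (\<exists>u\<in>W. \<exists>v\<in>V - W. {u, v} \<in> T))"
  have "(x, y) \<in> (adj T)\<^sup>*" if "x \<in> V" "y \<in> V" for x y
  proof (rule ccontr)
    assume "(x, y) \<notin> (adj T)\<^sup>*"
    define W where "W = {w \<in> V. (x, w) \<in> (adj T)\<^sup>*}"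
    have "W \<subseteq> V" "W \<noteq> {}" "W \<noteq> V"
      using that \<open>(x, y) \<notin> (adj T)\<^sup>*\<close> unfolding W_def by auto
    with cuts obtain u v where uv: "u \<in> W" "v \<in> V" "v \<notin> W" "{u, v} \<in> T" by blast
    then have "(x, v) \<in> (adj T)\<^sup>*"
      unfolding W_def by (auto intro: rtrancl.rtrancl_into_rtrancl)
    with uv show False unfolding W_def by blast
  qed
  with cuts show "ug_connected (V, T)" by (simp add: ug_connected_def)
qed

text \<open>Greedy growth: as long as W is a proper subset of V, some edge crosses the cut and
  attaches one more leaf.\<close>

lemma ug_connected_imp_grown:
  assumes "finite V" "T \<subseteq> Pow V" "ug_connected (V, T)"
  shows "\<exists>T'\<subseteq>T. grown V T'"
proof -
  have "\<exists>W T'. W \<subseteq> V \<and> T' \<subseteq> T \<and> grown W T' \<and> card W = Suc n" if "Suc n \<le> card V" for n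
    using that
  proof (induction n)
    case 0
    obtain v where "v \<in> V" using assms(3) by (auto simp: ug_connected_def)
    then show ?case by (intro exI[of _ "{v}"] exI[of _ "{}"]) (auto intro: grown_single)
  next
    case (Suc n)
    then obtain W T' where W: "W \<subseteq> V" "T' \<subseteq> T" "grown W T'" "card W = Suc n" by auto
    then have "W \<noteq> V" "W \<noteq> {}" using Suc.prems by auto
    with W assms obtain u v where "u \<in> W" "v \<in> V" "v \<notin> W" "{u, v} \<in> T"
      unfolding ug_connected_iff_cuts[OF assms(2)] by blast
    with W show ?case
      using grown_finite[OF W(3)]
      by (intro exI[of _ "insert v W"] exI[of _ "insert {u, v} T'"]) (auto intro: grown_leaf)
  qed
  moreover have "card V \<noteq> 0" using assms by (auto simp: ug_connected_def)
  ultimately obtain W T' where "W \<subseteq> V" "T' \<subseteq> T" "grown W T'" "card W = card V"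
    by (metis Suc_le_eq less_Suc_eq_le not0_implies_Suc order_refl)
  with assms(1) card_subset_eq show ?thesis by blast
qed

text \<open>Both directions compare T with a grown subtree T'. If T is acyclic, an edge outside T'
  would close a cycle with a path in T'; if the edge count is right, T' has as many edges as T and
  so equals T.\<close>

lemma ug_tree_iff_card:
  assumes "finite V" "T \<subseteq> {e. e \<subseteq> V \<and> card e = 2}"
  shows "ug_tree (V, T) \<longleftrightarrow> ug_connected (V, T) \<and> card V = card T + 1"
proof
  have TV: "T \<subseteq> Pow V" using assms(2) by auto
  {
    assume tree: "ug_tree (V, T)"
    then have con: "ug_connected (V, T)" by (simp add: ug_tree_def)
    from ug_connected_imp_grown[OF assms(1) TV this] obtain T' where T': "T' \<subseteq> T" "grown V T'"
      by blast
    have "T \<subseteq> T'"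
    proof
      fix e assume e: "e \<in> T"
      with assms(2) obtain x y where xy: "e = {x, y}" "x \<noteq> y" "x \<in> V" "y \<in> V"
        by (auto simp: card_2_iff)
      from grown_path[OF T'(2) xy(4,3)] obtain vs where vs: "vs \<noteq> []" "hd vs = y" "last vs = x"
        "distinct vs" "successively (\<lambda>a b. {a, b} \<in> T') vs" by blast
      show "e \<in> T'"
      proof (rule ccontr)
        assume "e \<notin> T'"
        \<comment> \<open>The path runs from y to x: length 1 would force x = y, and length 2 would
          put the edge e itself into T'.\<close>
        have "length vs \<noteq> 1"
          using vs xy(2) by (cases vs) auto
        moreover have "length vs \<noteq> 2"
        proof
          assume "length vs = 2"
          then obtain p q where "vs = [p, q]" by (auto simp: length_Suc_conv numeral_2_eq_2)
          with vs xy \<open>e \<notin> T'\<close> show False by (auto simp: insert_commute)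
        qed
        moreover have "length vs \<noteq> 0" using vs(1) by simp
        ultimately have len: "3 \<le> length vs" by linarith
        have "{vs ! i, vs ! (Suc i mod length vs)} \<in> T" if i: "i < length vs" for i
        proof (cases "Suc i = length vs")
          \<comment> \<open>The last index wraps around to 0, where the closing edge is e; all other
            edges come from T'.\<close>
          case True
          then have "vs ! i = x" "vs ! (Suc i mod length vs) = y"
            using vs(1-3) by (simp_all add: last_conv_nth hd_conv_nth flip: True)
          with e xy(1) show ?thesis by simp
        next
          case False
          with i have "Suc i < length vs" by simp
          then have "{vs ! i, vs ! Suc i} \<in> T'"
            using vs(5) by (simp add: successively_conv_nth)
          with \<open>Suc i < length vs\<close> T'(1) show ?thesis by auto
        qed
        with len vs(4) have "ug_cycle (V, T) vs" by (simp add: ug_cycle_def)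
        with tree show False by (auto simp: ug_tree_def)
      qed
    qed
    with T' grown_finite[OF T'(2)] con show "ug_connected (V, T) \<and> card V = card T + 1" by auto
  }
  assume con: "ug_connected (V, T) \<and> card V = card T + 1"
  with ug_connected_imp_grown[OF assms(1) TV] obtain T' where T': "T' \<subseteq> T" "grown V T'" by blast
  have "finite T" using TV assms(1) by (simp add: finite_subset)
  moreover have "card T' = card T" using grown_finite[OF T'(2)] con by simp
  ultimately have "T' = T" using T'(1) by (simp add: card_subset_eq)
  with con T'(2) grown_acyclic show "ug_tree (V, T)" by (auto simp: ug_tree_def)
qed

section \<open>The spanning trees of \<open>K\<^sub>5 - e\<close>\<close>

text \<open>The vertices are numbered from 0 to 4 so that the deleted edge is \<open>{0, 1}\<close>.\<close>

definition cuts_met :: "(nat \<times> nat) list \<Rightarrow> bool" where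
  "cuts_met S \<longleftrightarrow> (\<forall>w\<in>set (subseqs [0..<5]). w \<noteq> [] \<and> length w < 5 \<longrightarrow>
     (\<exists>(i, j)\<in>set S. (i \<in> set w) \<noteq> (j \<in> set w)))"

definition K5e_edges :: "(nat \<times> nat) list" where
  "K5e_edges = [(0,2),(0,3),(0,4),(1,2),(1,3),(1,4),(2,3),(2,4),(3,4)]"

definition K5e_trees :: "(nat \<times> nat) list list" where
  "K5e_trees = filter (\<lambda>S. length S = 4 \<and> cuts_met S) (subseqs K5e_edges)"

lemma cuts_met_K5e: "cuts_met K5e_edges"
  by code_simp

text \<open>The 75 spanning trees, found by evaluating the filter over all sublists of the nine
  edges; the explicit list lets the polynomial be expanded later.\<close>

lemma K5e_trees_eq: "K5e_trees = [
     [(0,2), (0,3), (0,4), (1,2)], [(0,2), (0,3), (0,4), (1,3)],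
     [(0,2), (0,3), (0,4), (1,4)], [(0,2), (0,3), (1,2), (1,4)],
     [(0,2), (0,3), (1,2), (2,4)], [(0,2), (0,3), (1,2), (3,4)],
     [(0,2), (0,3), (1,3), (1,4)], [(0,2), (0,3), (1,3), (2,4)],
     [(0,2), (0,3), (1,3), (3,4)], [(0,2), (0,3), (1,4), (2,4)],
     [(0,2), (0,3), (1,4), (3,4)], [(0,2), (0,4), (1,2), (1,3)],
     [(0,2), (0,4), (1,2), (2,3)], [(0,2), (0,4), (1,2), (3,4)],
     [(0,2), (0,4), (1,3), (1,4)], [(0,2), (0,4), (1,3), (2,3)],
     [(0,2), (0,4), (1,3), (3,4)], [(0,2), (0,4), (1,4), (2,3)],
     [(0,2), (0,4), (1,4), (3,4)], [(0,2), (1,2), (1,3), (1,4)],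
     [(0,2), (1,2), (1,3), (2,4)], [(0,2), (1,2), (1,3), (3,4)],
     [(0,2), (1,2), (1,4), (2,3)], [(0,2), (1,2), (1,4), (3,4)],
     [(0,2), (1,2), (2,3), (2,4)], [(0,2), (1,2), (2,3), (3,4)],
     [(0,2), (1,2), (2,4), (3,4)], [(0,2), (1,3), (1,4), (2,3)],
     [(0,2), (1,3), (1,4), (2,4)], [(0,2), (1,3), (2,3), (2,4)],
     [(0,2), (1,3), (2,3), (3,4)], [(0,2), (1,3), (2,4), (3,4)],
     [(0,2), (1,4), (2,3), (2,4)], [(0,2), (1,4), (2,3), (3,4)],
     [(0,2), (1,4), (2,4), (3,4)], [(0,3), (0,4), (1,2), (1,3)],
     [(0,3), (0,4), (1,2), (1,4)], [(0,3), (0,4), (1,2), (2,3)],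
     [(0,3), (0,4), (1,2), (2,4)], [(0,3), (0,4), (1,3), (2,3)],
     [(0,3), (0,4), (1,3), (2,4)], [(0,3), (0,4), (1,4), (2,3)],
     [(0,3), (0,4), (1,4), (2,4)], [(0,3), (1,2), (1,3), (1,4)],
     [(0,3), (1,2), (1,3), (2,4)], [(0,3), (1,2), (1,3), (3,4)],
     [(0,3), (1,2), (1,4), (2,3)], [(0,3), (1,2), (1,4), (3,4)],
     [(0,3), (1,2), (2,3), (2,4)], [(0,3), (1,2), (2,3), (3,4)],
     [(0,3), (1,2), (2,4), (3,4)], [(0,3), (1,3), (1,4), (2,3)],
     [(0,3), (1,3), (1,4), (2,4)], [(0,3), (1,3), (2,3), (2,4)],
     [(0,3), (1,3), (2,3), (3,4)], [(0,3), (1,3), (2,4), (3,4)],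
     [(0,3), (1,4), (2,3), (2,4)], [(0,3), (1,4), (2,3), (3,4)],
     [(0,3), (1,4), (2,4), (3,4)], [(0,4), (1,2), (1,3), (1,4)],
     [(0,4), (1,2), (1,3), (2,4)], [(0,4), (1,2), (1,3), (3,4)],
     [(0,4), (1,2), (1,4), (2,3)], [(0,4), (1,2), (1,4), (3,4)],
     [(0,4), (1,2), (2,3), (2,4)], [(0,4), (1,2), (2,3), (3,4)],
     [(0,4), (1,2), (2,4), (3,4)], [(0,4), (1,3), (1,4), (2,3)],
     [(0,4), (1,3), (1,4), (2,4)], [(0,4), (1,3), (2,3), (2,4)],
     [(0,4), (1,3), (2,3), (3,4)], [(0,4), (1,3), (2,4), (3,4)],
     [(0,4), (1,4), (2,3), (2,4)], [(0,4), (1,4), (2,3), (3,4)],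
     [(0,4), (1,4), (2,4), (3,4)]]"
  by code_simp

text \<open>The injective labelling carries the computation on numbers over to any five-element
  vertex set.\<close>

locale K5e =
  fixes \<phi> :: "nat \<Rightarrow> 'a"
  assumes inj: "inj_on \<phi> {..<5}"
begin

definition edge :: "nat \<times> nat \<Rightarrow> 'a set" where
  "edge p = {\<phi> (fst p), \<phi> (snd p)}"

abbreviation G :: "'a ugraph" where
  "G \<equiv> delete_edge (complete_ugraph (\<phi> ` {..<5})) {\<phi> 0, \<phi> (Suc 0)}"

lemma \<phi>_eq_iff: "i < 5 \<Longrightarrow> j < 5 \<Longrightarrow> \<phi> i = \<phi> j \<longleftrightarrow> i = j"
  using inj by (auto dest: inj_onD)

lemma K5e_edges_less: "(i, j) \<in> set K5e_edges \<Longrightarrow> i < j \<and> j < 5"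
  by (auto simp: K5e_edges_def)

lemma distinct_K5e_edges: "distinct K5e_edges"
  by (simp add: K5e_edges_def)

lemma inj_edge: "inj_on edge {(i, j). i < j \<and> j < 5}"
  by (auto simp: inj_on_def edge_def doubleton_eq_iff \<phi>_eq_iff)

lemma inj_edge': "inj_on edge (set K5e_edges)"
  by (rule inj_on_subset[OF inj_edge]) (auto dest: K5e_edges_less)

lemma pairs_eq: "{(i, j). i < j \<and> j < 5} - {(0, 1)} = set K5e_edges"
proof -
  have "i < j \<and> j < 5 \<and> (i, j) \<noteq> (0, 1) \<longleftrightarrow> (i, j) \<in> set K5e_edges" for i j :: nat
    by (simp add: K5e_edges_def) presburger
  then show ?thesis by auto
qed

lemma verts_G: "ug_verts G = \<phi> ` {..<5}"
  by (simp add: delete_edge_def complete_ugraph_def)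

lemma edges_G: "ug_edges G = edge ` set K5e_edges"
proof -
  have "{e. e \<subseteq> \<phi> ` {..<5} \<and> card e = 2} = edge ` {(i, j). i < j \<and> j < 5}"
  proof (intro set_eqI iffI)
    fix e assume "e \<in> {e. e \<subseteq> \<phi> ` {..<5} \<and> card e = 2}"
    then obtain x y where "e = {x, y}" "x \<noteq> y" "x \<in> \<phi> ` {..<5}" "y \<in> \<phi> ` {..<5}"
      by (auto simp: card_2_iff)
    then obtain i j where ij: "e = {\<phi> i, \<phi> j}" "i < 5" "j < 5" "i \<noteq> j" by blast
    show "e \<in> edge ` {(i, j). i < j \<and> j < 5}"
    proof (cases "i < j")
      case True
      with ij show ?thesis by (intro image_eqI[of _ _ "(i, j)"]) (auto simp: edge_def)
    next
      case False
      with ij show ?thesis by (intro image_eqI[of _ _ "(j, i)"]) (auto simp: edge_def)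
    qed
  qed (auto simp: edge_def card_insert_if \<phi>_eq_iff)
  then have "ug_edges G = edge ` {(i, j). i < j \<and> j < 5} - edge ` {(0, 1)}"
    by (simp add: delete_edge_def complete_ugraph_def edge_def)
  also have "\<dots> = edge ` ({(i, j). i < j \<and> j < 5} - {(0, 1)})"
    by (rule inj_on_image_set_diff[OF inj_edge, symmetric]) auto
  finally show ?thesis unfolding pairs_eq .
qed

lemma edges_G_card: "ug_edges G \<subseteq> {e. e \<subseteq> \<phi> ` {..<5} \<and> card e = 2}"
  by (auto simp: delete_edge_def complete_ugraph_def)

text \<open>Injectivity of \<phi> matches cuts of the image with subsets of the labels, and these in
  turn with sublists of \<open>[0..<5]\<close>.\<close>

lemma connected_iff_cuts_met:
  assumes S: "set S \<subseteq> set K5e_edges"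
  shows "ug_connected (\<phi> ` {..<5}, edge ` set S) \<longleftrightarrow> cuts_met S"
proof -
  have less: "i < 5" "j < 5" if "(i, j) \<in> set S" for i j
    using K5e_edges_less[OF subsetD[OF S that]] by simp_all
  have crossing: "(\<exists>u\<in>\<phi> ` w. \<exists>v\<in>\<phi> ` {..<5} - \<phi> ` w. {u, v} \<in> edge ` set S) \<longleftrightarrow>
      (\<exists>(i, j)\<in>set S. (i \<in> w) \<noteq> (j \<in> w))" if w: "w \<subseteq> {..<5}" for w
  proof -
    have mem: "\<phi> i \<in> \<phi> ` w \<longleftrightarrow> i \<in> w" if "i < 5" for i
      using w that inj by (auto dest: inj_onD)
    show ?thesis
    proof
      assume "\<exists>u\<in>\<phi> ` w. \<exists>v\<in>\<phi> ` {..<5} - \<phi> ` w. {u, v} \<in> edge ` set S"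
      then obtain u v p where uv: "u \<in> \<phi> ` w" "v \<notin> \<phi> ` w" and p: "p \<in> set S"
        "{u, v} = edge p" by blast
      obtain i j where "p = (i, j)" by (cases p)
      with p have ij: "(i, j) \<in> set S" "{u, v} = {\<phi> i, \<phi> j}" by (simp_all add: edge_def)
      from uv ij(2) have "(\<phi> i \<in> \<phi> ` w) \<noteq> (\<phi> j \<in> \<phi> ` w)" by (metis doubleton_eq_iff)
      then have "(i \<in> w) \<noteq> (j \<in> w)"
        using mem[OF less(1)[OF ij(1)]] mem[OF less(2)[OF ij(1)]] by simp
      with ij(1) show "\<exists>(i, j)\<in>set S. (i \<in> w) \<noteq> (j \<in> w)" by blast
    next
      assume "\<exists>(i, j)\<in>set S. (i \<in> w) \<noteq> (j \<in> w)"
      then obtain i j where ij: "(i, j) \<in> set S" "(i \<in> w) \<noteq> (j \<in> w)" by blast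
      have e: "{\<phi> i, \<phi> j} \<in> edge ` set S" "{\<phi> j, \<phi> i} \<in> edge ` set S"
        using imageI[OF ij(1), of edge] by (simp_all add: edge_def insert_commute)
      note ij5 = less[OF ij(1)]
      show "\<exists>u\<in>\<phi> ` w. \<exists>v\<in>\<phi> ` {..<5} - \<phi> ` w. {u, v} \<in> edge ` set S"
      proof (cases "i \<in> w")
        case True
        with ij(2) ij5 mem[OF ij5(2)] show ?thesis
          by (intro bexI[OF _ imageI[of i]] bexI[of _ "\<phi> j"] e(1)) simp_all
      next
        case False
        with ij(2) ij5 mem[OF ij5(1)] show ?thesis
          by (intro bexI[OF _ imageI[of j]] bexI[of _ "\<phi> i"] e(2)) simp_all
      qed
    qed
  qed
  have "edge ` set S \<subseteq> Pow (\<phi> ` {..<5})"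
  proof
    fix e assume "e \<in> edge ` set S"
    then obtain i j where "(i, j) \<in> set S" "e = {\<phi> i, \<phi> j}" by (auto simp: edge_def)
    with less[of i j] show "e \<in> Pow (\<phi> ` {..<5})" by simp
  qed
  then have "ug_connected (\<phi> ` {..<5}, edge ` set S) \<longleftrightarrow>
    (\<forall>W\<subseteq>\<phi> ` {..<5}. W \<noteq> {} \<longrightarrow> W \<noteq> \<phi> ` {..<5} \<longrightarrow>
      (\<exists>u\<in>W. \<exists>v\<in>\<phi> ` {..<5} - W. {u, v} \<in> edge ` set S))"
    using ug_connected_iff_cuts[of "edge ` set S" "\<phi> ` {..<5}"]
    by (simp only: image_is_empty lessThan_empty_iff) simp
  also have "\<dots> \<longleftrightarrow> (\<forall>w\<in>Pow {..<5}. w \<noteq> {} \<longrightarrow> w \<noteq> {..<5} \<longrightarrow>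
      (\<exists>(i, j)\<in>set S. (i \<in> w) \<noteq> (j \<in> w)))"
  proof -
    have "\<phi> ` w = \<phi> ` {..<5} \<longleftrightarrow> w = {..<5}" if "w \<subseteq> {..<5}" for w
      by (rule inj_on_image_eq_iff[OF inj that order_refl])
    with crossing show ?thesis
      by (simp only: all_subset_image Ball_def Pow_iff image_is_empty cong: imp_cong)
  qed
  also have "Pow {..<5} = set ` set (subseqs [0..<5])"
    by (simp add: subseqs_powset atLeast0LessThan)
  also have "(\<forall>w\<in>set ` set (subseqs [0..<5]). w \<noteq> {} \<longrightarrow> w \<noteq> {..<5} \<longrightarrow>
      (\<exists>(i, j)\<in>set S. (i \<in> w) \<noteq> (j \<in> w))) \<longleftrightarrow> cuts_met S"
  proof -
    have "set w \<noteq> {..<5} \<longleftrightarrow> length w < 5" if "w \<in> set (subseqs [0..<5])" for w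
    proof -
      have "distinct w" "set w \<subseteq> {..<5}"
        using subseqs_distinctD[OF that] that subseqs_powset[of "[0..<5]"]
        by (auto simp: atLeast0LessThan)
      then have "card (set w) = length w" "card (set w) \<le> 5"
        "card (set w) = 5 \<Longrightarrow> set w = {..<5}"
        using card_mono[of "{..<5}" "set w"] card_subset_eq[of "{..<5}" "set w"]
        by (simp_all add: distinct_card)
      then show ?thesis by (metis card_lessThan le_neq_implies_less less_irrefl)
    qed
    then show ?thesis
      unfolding cuts_met_def ball_simps imp_conjL by (intro ball_cong refl) (simp only: set_empty)
  qed
  finally show ?thesis .
qed

lemma tree_iff:
  assumes S: "S \<in> set (subseqs K5e_edges)"
  shows "ug_tree (\<phi> ` {..<5}, edge ` set S) \<longleftrightarrow> length S = 4 \<and> cuts_met S"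
proof -
  have sub: "set S \<subseteq> set K5e_edges" using S subseqs_powset[of K5e_edges] by blast
  have dist: "distinct S" by (rule subseqs_distinctD[OF S distinct_K5e_edges])
  have "card (\<phi> ` {..<5}) = 5" using card_image[OF inj] by simp
  moreover have "card (edge ` set S) = length S"
    using card_image[OF inj_on_subset[OF inj_edge' sub]] distinct_card[OF dist] by simp
  moreover have "edge ` set S \<subseteq> {e. e \<subseteq> \<phi> ` {..<5} \<and> card e = 2}"
    using edges_G_card image_mono[OF sub, of edge] unfolding edges_G by (rule order_trans[rotated])
  ultimately show ?thesis
    using ug_tree_iff_card[of "\<phi> ` {..<5}" "edge ` set S"] connected_iff_cuts_met[OF sub] by auto
qed

lemma spanning_trees_G: "spanning_trees G = (\<lambda>S. edge ` set S) ` set K5e_trees"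
proof -
  have "spanning_trees G = {T \<in> Pow (edge ` set K5e_edges). ug_tree (\<phi> ` {..<5}, T)}"
    unfolding spanning_trees_def verts_G edges_G by (simp only: Pow_iff)
  also have "Pow (edge ` set K5e_edges) = (\<lambda>S. edge ` set S) ` set (subseqs K5e_edges)"
    by (simp only: image_Pow_surj[OF refl, symmetric] subseqs_powset[symmetric] image_image)
  also have "{T \<in> (\<lambda>S. edge ` set S) ` set (subseqs K5e_edges). ug_tree (\<phi> ` {..<5}, T)} =
      (\<lambda>S. edge ` set S) ` {S \<in> set (subseqs K5e_edges). ug_tree (\<phi> ` {..<5}, edge ` set S)}"
    by (rule Compr_image_eq)
  also have "{S \<in> set (subseqs K5e_edges). ug_tree (\<phi> ` {..<5}, edge ` set S)} = set K5e_trees"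
    using tree_iff by (simp only: K5e_trees_def set_filter cong: conj_cong)
  finally show ?thesis .
qed

lemma spanning_tree_poly_G:
  "spanning_tree_poly G x = (\<Sum>S\<leftarrow>K5e_trees. \<Prod>p\<leftarrow>S. x (edge p))"
proof -
  have sub: "S \<in> set (subseqs K5e_edges)" if "S \<in> set K5e_trees" for S
    using that by (simp add: K5e_trees_def)
  have "inj_on ((`) edge) (Pow (set K5e_edges))"
    by (rule inj_on_image_Pow[OF inj_edge'])
  moreover have "distinct (map set (subseqs K5e_edges))"
    by (rule distinct_set_subseqs[OF distinct_K5e_edges])
  \<comment> \<open>Distinct sublists have distinct sets, and \<open>edge\<close> is injective on
    the listed pairs, so no tree is counted twice when the sum runs over the list.\<close>
  ultimately have "inj_on ((`) edge \<circ> set) (set (subseqs K5e_edges))"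
    by (intro comp_inj_on) (simp_all add: distinct_map subseqs_powset)
  then have inj_trees: "inj_on (\<lambda>S. edge ` set S) (set K5e_trees)"
    unfolding comp_def by (rule inj_on_subset) (use sub in blast)
  have "spanning_tree_poly G x = (\<Sum>S\<in>set K5e_trees. \<Prod>e\<in>edge ` set S. x e)"
    unfolding spanning_tree_poly_def spanning_trees_G by (simp add: sum.reindex[OF inj_trees])
  also have "\<dots> = (\<Sum>S\<in>set K5e_trees. \<Prod>p\<leftarrow>S. x (edge p))"
  proof (rule sum.cong[OF refl])
    fix S assume S: "S \<in> set K5e_trees"
    have "set S \<subseteq> set K5e_edges" using sub[OF S] subseqs_powset[of K5e_edges] by auto
    then have "inj_on edge (set S)" by (rule inj_on_subset[OF inj_edge'])
    then show "(\<Prod>e\<in>edge ` set S. x e) = (\<Prod>p\<leftarrow>S. x (edge p))"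
      using subseqs_distinctD[OF sub[OF S] distinct_K5e_edges] by (simp add: prod.reindex prod.distinct_set_conv_list)
  qed
  also have "\<dots> = (\<Sum>S\<leftarrow>K5e_trees. \<Prod>p\<leftarrow>S. x (edge p))"
    using \<open>distinct (map set (subseqs K5e_edges))\<close>
    by (intro sum.distinct_set_conv_list) (simp add: K5e_trees_def distinct_map)
  finally show ?thesis .
qed

lemma finite_G: "finite_ugraph G"
  unfolding finite_ugraph_def verts_G using edges_G_card by simp

lemma connected_G: "ug_connected G"
proof -
  have "ug_connected (ug_verts G, ug_edges G)"
    unfolding verts_G edges_G using connected_iff_cuts_met[OF order_refl] cuts_met_K5e by blast
  then show ?thesis by (simp only: prod.collapse)
qed

end

section \<open>Complete monotonicity\<close>

text \<open>The determinant of a sum of three symmetric 2 by 2 matrices is the sum of their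
  determinants and mixed terms. The terms p1 r1 - q1^2 and p2 r2 - q2^2 carry squared denominators;
  divisibility by A and B makes the whole expression polynomial.\<close>

lemma det_schur_identity:
  fixes A B :: real
  assumes "A \<noteq> 0" "B \<noteq> 0" "p1 * r1 - q1\<^sup>2 = A * d1" "p2 * r2 - q2\<^sup>2 = B * d2"
  shows "A * B * ((p0 + p1 / A + p2 / B) * (r0 + r1 / A + r2 / B) - (q0 + q1 / A + q2 / B)\<^sup>2) =
    A * B * (p0 * r0 - q0\<^sup>2) + B * (p0 * r1 + r0 * p1 - 2 * q0 * q1)
    + A * (p0 * r2 + r0 * p2 - 2 * q0 * q2) + (p1 * r2 + p2 * r1 - 2 * q1 * q2) + B * d1 + A * d2"
proof -
  have "A * B * ((p0 + p1 / A + p2 / B) * (r0 + r1 / A + r2 / B) - (q0 + q1 / A + q2 / B)\<^sup>2) =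
    A * B * (p0 * r0 - q0\<^sup>2) + B * (p0 * r1 + r0 * p1 - 2 * q0 * q1)
    + A * (p0 * r2 + r0 * p2 - 2 * q0 * q2) + (p1 * r2 + p2 * r1 - 2 * q1 * q2)
    + B * ((p1 * r1 - q1\<^sup>2) / A) + A * ((p2 * r2 - q2\<^sup>2) / B)"
    using assms(1,2) by (simp add: field_simps power2_eq_square)
  then show ?thesis using assms by simp
qed

section \<open>Elimination of the two non-adjacent vertices\<close>

context K5e
begin

abbreviation wt :: "('a set \<Rightarrow> real) \<Rightarrow> nat \<Rightarrow> nat \<Rightarrow> real" where
  "wt x i j \<equiv> x (edge (i, j))"

definition deg0 :: "('a set \<Rightarrow> real) \<Rightarrow> real" where
  "deg0 x = wt x 0 2 + wt x 0 3 + wt x 0 4"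

definition deg1 :: "('a set \<Rightarrow> real) \<Rightarrow> real" where
  "deg1 x = wt x 1 2 + wt x 1 3 + wt x 1 4"

text \<open>The Schur complement, with respect to vertices 0 and 1, of the weighted Laplacian
  with the row and column of vertex 2 deleted.\<close>

definition schur33 :: "('a set \<Rightarrow> real) \<Rightarrow> real" where
  "schur33 x = wt x 2 3 + wt x 3 4 + wt x 0 3 * (wt x 0 2 + wt x 0 4) / deg0 x
    + wt x 1 3 * (wt x 1 2 + wt x 1 4) / deg1 x"

definition schur34 :: "('a set \<Rightarrow> real) \<Rightarrow> real" where
  "schur34 x = - wt x 3 4 + - (wt x 0 3 * wt x 0 4) / deg0 x + - (wt x 1 3 * wt x 1 4) / deg1 x"

definition schur44 :: "('a set \<Rightarrow> real) \<Rightarrow> real" where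
  "schur44 x = wt x 2 4 + wt x 3 4 + wt x 0 4 * (wt x 0 2 + wt x 0 3) / deg0 x
    + wt x 1 4 * (wt x 1 2 + wt x 1 3) / deg1 x"

text \<open>This is the matrix-tree theorem with a Schur complement: vertices 0 and 1 are not
  adjacent, so their block of the Laplacian is diagonal with determinant
  \<open>deg0 x * deg1 x\<close>. It is verified here by expanding both sides.\<close>

lemma spanning_tree_poly_schur:
  assumes "deg0 x \<noteq> 0" "deg1 x \<noteq> 0"
  shows "spanning_tree_poly G x = deg0 x * deg1 x * (schur33 x * schur44 x - (schur34 x)\<^sup>2)"
proof -
  have "deg0 x * deg1 x * (schur33 x * schur44 x - (schur34 x)\<^sup>2) =
    deg0 x * deg1 x * ((wt x 2 3 + wt x 3 4) * (wt x 2 4 + wt x 3 4) - (- wt x 3 4)\<^sup>2)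
    + deg1 x * ((wt x 2 3 + wt x 3 4) * (wt x 0 4 * (wt x 0 2 + wt x 0 3))
      + (wt x 2 4 + wt x 3 4) * (wt x 0 3 * (wt x 0 2 + wt x 0 4))
      - 2 * (- wt x 3 4) * (- (wt x 0 3 * wt x 0 4)))
    + deg0 x * ((wt x 2 3 + wt x 3 4) * (wt x 1 4 * (wt x 1 2 + wt x 1 3))
      + (wt x 2 4 + wt x 3 4) * (wt x 1 3 * (wt x 1 2 + wt x 1 4))
      - 2 * (- wt x 3 4) * (- (wt x 1 3 * wt x 1 4)))
    + (wt x 0 3 * (wt x 0 2 + wt x 0 4) * (wt x 1 4 * (wt x 1 2 + wt x 1 3))
      + wt x 1 3 * (wt x 1 2 + wt x 1 4) * (wt x 0 4 * (wt x 0 2 + wt x 0 3))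
      - 2 * (- (wt x 0 3 * wt x 0 4)) * (- (wt x 1 3 * wt x 1 4)))
    + deg1 x * (wt x 0 2 * wt x 0 3 * wt x 0 4) + deg0 x * (wt x 1 2 * wt x 1 3 * wt x 1 4)"
    unfolding schur33_def schur34_def schur44_def
    \<comment> \<open>The divisibility hypotheses hold with d1 and d2 the products of the three
      weights at vertex 0 and at vertex 1.\<close>
    by (rule det_schur_identity[OF assms])
       (simp_all add: deg0_def deg1_def power2_eq_square algebra_simps)
  also have "\<dots> = spanning_tree_poly G x"
    unfolding spanning_tree_poly_G K5e_trees_eq list.map sum_list.Cons sum_list.Nil
      prod_list.Cons prod_list.Nil
    by (simp add: deg0_def deg1_def power2_eq_square algebra_simps)
  finally show ?thesis by simp
qed

lemma finite_edges: "finite (ug_edges G)"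
  by (simp add: edges_G)

lemma edge_in_G: "p \<in> set K5e_edges \<Longrightarrow> edge p \<in> ug_edges G"
  by (simp add: edges_G)

lemma wt_pos:
  assumes "x \<in> pos_cone (ug_edges G)" "(i, j) \<in> set K5e_edges"
  shows "0 < wt x i j"
  by (rule pos_coneD[OF assms(1) edge_in_G[OF assms(2)]])

lemma degs_pos:
  assumes "x \<in> pos_cone (ug_edges G)"
  shows "0 < deg0 x" "0 < deg1 x"
  unfolding deg0_def deg1_def
  by (intro add_pos_pos wt_pos[OF assms]; simp add: K5e_edges_def)+

lemma schur44_pos:
  assumes "x \<in> pos_cone (ug_edges G)"
  shows "0 < schur44 x"
  unfolding schur44_def
  by (intro add_pos_pos divide_pos_pos mult_pos_pos degs_pos[OF assms] wt_pos[OF assms];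
      simp add: K5e_edges_def)

lemma spanning_tree_poly_pos:
  assumes "x \<in> pos_cone (ug_edges G)"
  shows "0 < spanning_tree_poly G x"
proof -
  have S: "0 < (\<Prod>e\<in>T. x e)" if "T \<in> spanning_trees G" for T
    using that assms by (intro prod_pos) (auto simp: spanning_trees_def intro: pos_coneD)
  moreover have "finite (spanning_trees G)" by (simp add: spanning_trees_G)
  moreover have "spanning_trees G \<noteq> {}" unfolding spanning_trees_G K5e_trees_eq by simp
  ultimately show ?thesis unfolding spanning_tree_poly_def by (intro sum_pos) auto
qed

lemma sum_edges:
  fixes f :: "'a set \<Rightarrow> real"
  assumes "K \<subseteq> set K5e_edges"
  shows "(\<Sum>e\<in>edge ` K. f e) = (\<Sum>p\<in>K. f (edge p))"
  using sum.reindex[OF inj_on_subset[OF inj_edge' assms], of f] by simp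

lemma fully_alternating_exp_edges:
  assumes "K \<subseteq> set K5e_edges" "\<And>p. p \<in> K \<Longrightarrow> 0 \<le> c p"
  shows "fully_alternating (ug_edges G) (\<lambda>x. exp (- (\<Sum>p\<in>K. c p * x (edge p))))"
proof -
  note inj = inj_on_subset[OF inj_edge' assms(1)]
  have "fully_alternating (ug_edges G)
      (\<lambda>x. exp (- (\<Sum>e\<in>edge ` K. c (the_inv_into K edge e) * x e)))"
    using assms by (intro fully_alternating_exp finite_edges)
      (auto simp: edges_G the_inv_into_f_f[OF inj])
  then show ?thesis
    unfolding sum_edges[OF assms(1)] by (simp add: the_inv_into_f_f[OF inj] cong: sum.cong)
qed

lemma fully_alternating_star_edges:
  assumes "K \<subseteq> set K5e_edges" "K \<noteq> {}"
  shows "fully_alternating (ug_edges G) (\<lambda>x. (\<Sum>p\<in>K. x (edge p)) powr (- 1/2) *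
    exp (- ((\<Sum>p\<in>K. x (edge p) * (c p)\<^sup>2) - (\<Sum>p\<in>K. x (edge p) * c p)\<^sup>2 / (\<Sum>p\<in>K. x (edge p)))))"
proof -
  note inj = inj_on_subset[OF inj_edge' assms(1)]
  have "edge ` K \<subseteq> ug_edges G" "edge ` K \<noteq> {}" using assms by (auto simp: edges_G)
  from fully_alternating_star[OF finite_edges this, of "\<lambda>e. c (the_inv_into K edge e)"]
  show ?thesis
    unfolding sum_edges[OF assms(1)] by (simp add: the_inv_into_f_f[OF inj] cong: sum.cong)
qed

lemma fully_alternating_degs_powr:
  assumes "0 < s"
  shows "fully_alternating (ug_edges G) (\<lambda>x. deg0 x powr (- s))"
    and "fully_alternating (ug_edges G) (\<lambda>x. deg1 x powr (- s))"
proof -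
  have "fully_alternating (ug_edges G) (\<lambda>x. (\<Sum>p\<in>K. x (edge p)) powr (- s))"
    if K: "K \<subseteq> set K5e_edges" "K \<noteq> {}" for K
  proof -
    have "edge ` K \<subseteq> ug_edges G" "edge ` K \<noteq> {}" using K by (auto simp: edges_G)
    from fully_alternating_sum_powr[OF finite_edges this assms] show ?thesis
      unfolding sum_edges[OF K(1)] .
  qed
  from this[of "{(0, 2), (0, 3), (0, 4)}"] this[of "{(1, 2), (1, 3), (1, 4)}"]
  show "fully_alternating (ug_edges G) (\<lambda>x. deg0 x powr (- s))"
    "fully_alternating (ug_edges G) (\<lambda>x. deg1 x powr (- s))"
    by (simp_all add: K5e_edges_def deg0_def deg1_def add.assoc)
qed

text \<open>Vertices 2, 3, 4 sit on a line at 0, r, u. Integrating over the positions of vertices 0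
  and 1 gives two star factors, the edges among 2, 3, 4 give a plain exponential, and the exponents
  add up to the quadratic form of the Schur complement.\<close>

lemma fully_alternating_energy:
  "fully_alternating (ug_edges G) (\<lambda>x. deg0 x powr (- 1/2) * deg1 x powr (- 1/2) *
    exp (- (schur33 x * r\<^sup>2 + 2 * schur34 x * r * u + schur44 x * u\<^sup>2)))"
proof (rule fully_alternating_cong)
  \<comment> \<open>\<open>?c\<close> is the position of the outer end of a star edge;
    \<open>?t\<close> below is the squared length of an edge of the triangle on 2, 3, 4.\<close>
  let ?c = "\<lambda>(i::nat, j). if j = 3 then r else if j = 4 then u else 0"
  let ?S = "\<lambda>K x. (\<Sum>p\<in>K. x (edge p)) powr (- 1/2) *
    exp (- ((\<Sum>p\<in>K. x (edge p) * (?c p)\<^sup>2) - (\<Sum>p\<in>K. x (edge p) * ?c p)\<^sup>2 / (\<Sum>p\<in>K. x (edge p))))"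
  let ?t = "\<lambda>(i::nat, j::nat). if i = 3 then (r - u)\<^sup>2 else if j = 3 then r\<^sup>2 else u\<^sup>2"
  let ?E = "\<lambda>x. exp (- (\<Sum>p\<in>{(2, 3), (2, 4), (3, 4)}. ?t p * x (edge p)))"
  let ?K = "{(0, 2), (0, 3), (0, 4)} :: (nat \<times> nat) set"
  let ?L = "{(1, 2), (1, 3), (1, 4)} :: (nat \<times> nat) set"
  show "fully_alternating (ug_edges G) (\<lambda>x. ?S ?K x * ?S ?L x * ?E x)"
    by (intro fully_alternating_mult fully_alternating_star_edges fully_alternating_exp_edges)
       (auto simp: K5e_edges_def)
  fix x assume x: "x \<in> pos_cone (ug_edges G)"
  note pos = degs_pos[OF x]
  let ?A = "wt x 0 3 * r\<^sup>2 + wt x 0 4 * u\<^sup>2 - (wt x 0 3 * r + wt x 0 4 * u)\<^sup>2 / deg0 x"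
  let ?B = "wt x 1 3 * r\<^sup>2 + wt x 1 4 * u\<^sup>2 - (wt x 1 3 * r + wt x 1 4 * u)\<^sup>2 / deg1 x"
  let ?C = "r\<^sup>2 * wt x 2 3 + u\<^sup>2 * wt x 2 4 + (r - u)\<^sup>2 * wt x 3 4"
  have energy: "schur33 x * r\<^sup>2 + 2 * schur34 x * r * u + schur44 x * u\<^sup>2 = ?A + ?B + ?C"
  proof -
    \<comment> \<open>The star-triangle formula: the Laplacian form of the triangle with weights
      such as a3 a4 / A, its vertex 2 held at 0, is the minimal energy of the star.\<close>
    have *: "a3 * (a2 + a4) / A * r\<^sup>2 + 2 * (- (a3 * a4) / A) * r * u + a4 * (a2 + a3) / A * u\<^sup>2
        = a3 * r\<^sup>2 + a4 * u\<^sup>2 - (a3 * r + a4 * u)\<^sup>2 / A"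
      if "A = a2 + a3 + a4" "0 < A" for A a2 a3 a4 :: real
    proof -
      have eq: "a2 + a4 = A - a3" "a2 + a3 = A - a4" using that(1) by simp_all
      show ?thesis unfolding eq using that(2) by (simp add: field_simps power2_eq_square)
    qed
    show ?thesis
      unfolding *[OF deg0_def pos(1), symmetric] *[OF deg1_def pos(2), symmetric]
        schur33_def schur34_def schur44_def
      by (simp add: power2_eq_square algebra_simps)
  qed
  have "?S ?K x = deg0 x powr (- 1/2) * exp (- ?A)"
    by (simp add: deg0_def add.assoc)
  moreover have "?S ?L x = deg1 x powr (- 1/2) * exp (- ?B)"
    by (simp add: deg1_def add.assoc)
  moreover have "?E x = exp (- ?C)"
    by (simp add: add.assoc)
  ultimately show "?S ?K x * ?S ?L x * ?E x = deg0 x powr (- 1/2) * deg1 x powr (- 1/2) *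
      exp (- (schur33 x * r\<^sup>2 + 2 * schur34 x * r * u + schur44 x * u\<^sup>2))"
    unfolding energy by (simp only: minus_add_distrib exp_add mult_ac)
qed

lemma completely_monotone_G:
  assumes "1 < \<beta>"
  shows "completely_monotone (ug_edges G) (\<lambda>x. spanning_tree_poly G x powr (- \<beta>))"
proof (rule completely_monotone_if_alternating)
  have "elementary (ug_edges G) (spanning_tree_poly G)"
    unfolding spanning_tree_poly_def[abs_def]
  proof (intro elementary_sum elementary_prod elementary_coord)
    show "finite (spanning_trees G)" by (simp add: spanning_trees_G)
    show "finite T" if "T \<in> spanning_trees G" for T
      using that finite_edges by (auto simp: spanning_trees_def intro: finite_subset)
    show "e \<in> ug_edges G" if "T \<in> spanning_trees G" "e \<in> T" for T e
      using that by (auto simp: spanning_trees_def)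
  qed
  then show "smooth_on_cone (ug_edges G) (\<lambda>x. spanning_tree_poly G x powr (- \<beta>))"
    by (intro elementary_smooth elementary_powr spanning_tree_poly_pos)
  let ?D = "\<lambda>x. schur33 x * schur44 x - (schur34 x)\<^sup>2"
  have poly: "spanning_tree_poly G x = deg0 x * deg1 x * ?D x" if "x \<in> pos_cone (ug_edges G)" for x
    using degs_pos[OF that] by (intro spanning_tree_poly_schur) auto
  \<comment> \<open>Positivity of the determinant is read off from positivity of the tree polynomial
    and of the two degrees.\<close>
  have D: "0 < ?D x" if "x \<in> pos_cone (ug_edges G)" for x
    using spanning_tree_poly_pos[OF that] mult_pos_pos[OF degs_pos[OF that]]
    unfolding poly[OF that] by (rule zero_less_mult_pos)
  have "fully_alternating (ug_edges G) (\<lambda>x. deg0 x powr (- \<beta>) * deg1 x powr (- \<beta>) * ?D x powr (- \<beta>))"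
  proof (rule fully_alternating_det_powr[OF _ schur44_pos D])
    fix r u v :: real
    let ?E = "\<lambda>r u x. exp (- (schur33 x * r\<^sup>2 + 2 * schur34 x * r * u + schur44 x * u\<^sup>2))"
    \<comment> \<open>The two coordinates of the plane separate: \<open>?H r u\<close> is the first
      coordinate, and \<open>?H 0 v\<close> the second, where only the term
      \<open>schur44 x * v\<^sup>2\<close> survives.\<close>
    let ?H = "\<lambda>r u x. deg0 x powr (- 1/2) * deg1 x powr (- 1/2) * ?E r u x"
    \<comment> \<open>Each coordinate contributes a degree to the power -1/2, two coordinates the
      power -1; the remaining exponent -(\<beta> - 1) is negative exactly because \<beta> exceeds
      1.\<close>
    have half: "d powr (- (\<beta> - 1)) * (d powr (- 1/2) * d powr (- 1/2)) = d powr (- \<beta>)" for d :: real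
      by (simp only: powr_add[symmetric]) simp
    have eq: "deg0 x powr (- (\<beta> - 1)) * (deg1 x powr (- (\<beta> - 1)) * (?H r u x * ?H 0 v x)) =
        deg0 x powr (- \<beta>) * deg1 x powr (- \<beta>) * ?E r u x * exp (- (schur44 x * v\<^sup>2))" for x
    proof -
      have "a * (b * (c * d * p * (c * d * q))) = a * (c * c) * (b * (d * d)) * p * q"
        for a b c d p q :: real by (simp only: mult_ac)
      then show ?thesis by (simp only: half) simp
    qed
    have "fully_alternating (ug_edges G) (\<lambda>x. deg0 x powr (- (\<beta> - 1)) *
        (deg1 x powr (- (\<beta> - 1)) * (?H r u x * ?H 0 v x)))"
      using assms
      by (intro fully_alternating_mult fully_alternating_energy fully_alternating_degs_powr) simp_all
    then show "fully_alternating (ug_edges G) (\<lambda>x. deg0 x powr (- \<beta>) * deg1 x powr (- \<beta>) *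
        ?E r u x * exp (- (schur44 x * v\<^sup>2)))"
      by (rule fully_alternating_cong) (rule eq)
  qed (use assms in simp)
  then show "fully_alternating (ug_edges G) (\<lambda>x. spanning_tree_poly G x powr (- \<beta>))"
  proof (rule fully_alternating_cong)
    fix x assume x: "x \<in> pos_cone (ug_edges G)"
    show "deg0 x powr (- \<beta>) * deg1 x powr (- \<beta>) * ?D x powr (- \<beta>) = spanning_tree_poly G x powr (- \<beta>)"
      unfolding poly[OF x] using degs_pos[OF x] D[OF x] by (simp add: powr_mult)
  qed
qed

end

theorem corollary6p3:
  fixes V :: "'a set" and e :: "'a set"
  assumes "card V = 5"
    and "e \<in> ug_edges (complete_ugraph V)"
  shows "(\<forall>\<beta>::real. \<beta> > 1 \<longrightarrow>
            completely_monotone (ug_edges (delete_edge (complete_ugraph V) e))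
              (\<lambda>x. spanning_tree_poly (delete_edge (complete_ugraph V) e) x powr (-\<beta>))) \<and>
         (\<forall>\<beta>::real. 1 < \<beta> \<and> \<beta> < 3/2 \<longrightarrow>
            delete_edge (complete_ugraph V) e \<in> cm_graphs \<beta>)"
proof -
  have "finite V" using assms(1) by (intro card_ge_0_finite) simp
  from assms(2) obtain a b where ab: "e = {a, b}" "a \<noteq> b" "a \<in> V" "b \<in> V"
    by (auto simp: complete_ugraph_def card_2_iff)
  have "card (V - {a, b}) = 3"
    using \<open>finite V\<close> assms(1) ab by (simp add: card_Diff_subset)
  then obtain c d f where cdf: "V - {a, b} = {c, d, f}" "c \<noteq> d" "d \<noteq> f" "c \<noteq> f"
    unfolding card_3_iff by auto
  \<comment> \<open>The ends of the deleted edge receive the labels 0 and 1, as the locale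
    expects.\<close>
  define \<phi> where "\<phi> = (!) [a, b, c, d, f]"
  have dist: "distinct [a, b, c, d, f]" using cdf ab by auto
  have V: "V = \<phi> ` {..<5}"
  proof -
    have "V = set [a, b, c, d, f]" using cdf(1) ab by auto
    also have "\<dots> = \<phi> ` {..<length [a, b, c, d, f]}"
      unfolding \<phi>_def set_conv_nth by blast
    finally show ?thesis by (simp add: eval_nat_numeral)
  qed
  interpret K5e \<phi>
    using inj_on_nth[OF dist, of "{..<5}"] by unfold_locales (simp add: \<phi>_def)
  have "delete_edge (complete_ugraph V) e = G"
    unfolding V ab(1) by (simp add: \<phi>_def)
  then show ?thesis
    using completely_monotone_G finite_G connected_G by (simp add: cm_graphs_def)
qed

end
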